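(* Let $\alpha\in(0,1)$ and let $n\in\mathbb{N}$, $n\ge2$. There is a constant $c>0$ depending on $\alpha$ such that for any $r>0$, any Borel subset $A$ of $\mathbb{R}^n$, and any $C>0$ such that $\nu_\alpha^n(A)>1/C$, $$\nu_\alpha^n\Big(x\notin A+C(\log n)^{\frac1\alpha-1}\big(\sqrt r\,B_{\ell^2}+r\,B_{\ell^1}\big)+r^{\frac1\alpha}B_{\ell^\alpha}\Big)\le\frac{e^{-cr}}{\nu_\alpha^n(A)-1/C}.$$
   Context: $\nu_\alpha$ is the probability measure on $\mathbb{R}$ with density $Y_\alpha^{-1}e^{-|x|^\alpha}$ ($Y_\alpha$ the normalizing constant) and $\nu_\alpha^n$ its $n$-fold product on $\mathbb{R}^n$. For $p>0$, $B_{\ell^p}=\{x\in\mathbb{R}^n:\sum_{i=1}^n|x_i|^p\le1\}$. Sums of sets are Minkowski sums. The constant $c$ does not depend on $n$. *)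

theory Defs
  imports "HOL-Probability.Probability"
begin

text \<open>
  The dimension \<open>n\<close> is quantified inside the theorem (after the constant \<open>c\<close>), so
  \<open>\<real>\<^sup>n\<close> is modelled by the extensional functions \<open>{..<n} \<rightarrow>\<^sub>E UNIV\<close>, i.e. the space of the
  library's product measures \<open>\<Pi>\<^sub>M i\<in>{..<n}. M\<close>.
\<close>

definition rspace :: "nat \<Rightarrow> (nat \<Rightarrow> real) set" where
  "rspace n = {..<n} \<rightarrow>\<^sub>E UNIV"

definition borel_pow :: "nat \<Rightarrow> (nat \<Rightarrow> real) measure" where
  "borel_pow n = (\<Pi>\<^sub>M i\<in>{..<n}. borel)"

definition norm_const :: "real \<Rightarrow> real" where
  "norm_const \<alpha> = (LINT x|lborel. exp (- (\<bar>x\<bar> powr \<alpha>)))"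

definition nu :: "real \<Rightarrow> real measure" where
  "nu \<alpha> = density lborel (\<lambda>x. ennreal (exp (- (\<bar>x\<bar> powr \<alpha>)) / norm_const \<alpha>))"

definition nu_pow :: "real \<Rightarrow> nat \<Rightarrow> (nat \<Rightarrow> real) measure" where
  "nu_pow \<alpha> n = (\<Pi>\<^sub>M i\<in>{..<n}. nu \<alpha>)"

definition lp_ball :: "nat \<Rightarrow> real \<Rightarrow> (nat \<Rightarrow> real) set" where
  "lp_ball n p = {x \<in> rspace n. (\<Sum>i<n. \<bar>x i\<bar> powr p) \<le> 1}"

text \<open>
  The pointwise operations are restricted to \<open>{..<n}\<close>: the sum of two extensional functions
  is in general not extensional, so the set operations of \<open>Set_Algebras\<close> do not apply.
\<close>

definition minkowski_sum ::
    "nat \<Rightarrow> (nat \<Rightarrow> real) set \<Rightarrow> (nat \<Rightarrow> real) set \<Rightarrow> (nat \<Rightarrow> real) set" where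
  "minkowski_sum n A B = {restrict (\<lambda>i. x i + y i) {..<n} |x y. x \<in> A \<and> y \<in> B}"

definition dilate :: "nat \<Rightarrow> real \<Rightarrow> (nat \<Rightarrow> real) set \<Rightarrow> (nat \<Rightarrow> real) set" where
  "dilate n t A = {restrict (\<lambda>i. t * x i) {..<n} |x. x \<in> A}"

text \<open>\<open>A + C (log n)\<^bsup>1/\<alpha>-1\<^esup> (\<surd>r B\<^sub>2 + r B\<^sub>1) + r\<^bsup>1/\<alpha>\<^esup> B\<^sub>\<alpha>\<close>\<close>

definition enlargement ::
    "real \<Rightarrow> nat \<Rightarrow> real \<Rightarrow> real \<Rightarrow> (nat \<Rightarrow> real) set \<Rightarrow> (nat \<Rightarrow> real) set" where
  "enlargement \<alpha> n C r A =
     minkowski_sum n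
       (minkowski_sum n A
         (dilate n (C * ln (real n) powr (1 / \<alpha> - 1))
           (minkowski_sum n (dilate n (sqrt r) (lp_ball n 2)) (dilate n r (lp_ball n 1)))))
       (dilate n (r powr (1 / \<alpha>)) (lp_ball n \<alpha>))"

text \<open>
  The enlargement of a Borel set by compact sets is an analytic set.  It need not be Borel, but
  it is universally measurable, so its probability is taken in the completion of \<open>nu_pow \<alpha> n\<close>;
  in \<open>nu_pow \<alpha> n\<close> itself \<open>measure\<close> would return the default value 0 on non-Borel sets.
\<close>

definition nu_pow_complete :: "real \<Rightarrow> nat \<Rightarrow> (nat \<Rightarrow> real) measure" where
  "nu_pow_complete \<alpha> n = completion (nu_pow \<alpha> n)"

end

theory Submission
  imports Defs "HOL-Real_Asymp.Real_Asymp"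
begin

text \<open>
  The measure \<open>nu\<close> is handled through Talagrand's concentration for the exponential law, in the functional
  form due to Maurey.  A measure has the transport property for a cost \<open>c\<close> if
  \<open>F x * G y \<le> exp (c x y)\<close> for all \<open>x\<close> and \<open>y\<close> forces the product of the integrals of \<open>F\<close> and \<open>G\<close> to be at most 1.
  With \<open>F\<close> and \<open>G\<close> multiples of indicators this says that two sets at cost at least \<open>t\<close> from each other
  have measures with product at most \<open>exp (- t)\<close> (\<open>transport_property_separated\<close>).  The property passes to
  products with the sum of the costs, and to images.

  On the half-line the exponential law has the property for a cost that is quadratic for small and
  linear for large distances (\<open>transport_property_exponential\<close>).  This is a variant of the proof of the
  Prekopa--Leindler inequality by transport of mass, with the arithmetic mean replaced by a mean that is pushed
  towards the origin; the heart is \<open>exponential_transport_bounded\<close>.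

  The measure \<open>nu\<close> is the image of two independent exponential variables under an increasing function of
  their difference.  Since the hazard rate of \<open>nu\<close> at \<open>y\<close> is at least of order \<open>y powr (\<alpha> - 1)\<close> for large \<open>y\<close>, that function is
  a contraction in the coordinate \<open>profile\<close>, which is of order \<open>y powr \<alpha>\<close>.  So \<open>nu\<close> has the property with the cost
  measured in that coordinate (\<open>transport_property_nu\<close>), and so do its powers.

  It remains to translate a small cost between \<open>x\<close> and \<open>y\<close> into membership of \<open>y\<close> in the enlargement.  If the
  coordinates of \<open>x\<close> are bounded by \<open>M \<ge> 1\<close>, then a change of the profile by \<open>u\<close> moves a coordinate by at most a
  multiple of \<open>M powr (1 - \<alpha>) * u + u powr (1/\<alpha>)\<close> (\<open>displacement_le\<close>), and the coordinates can be distributed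
  over the three balls (\<open>mem_enlargement_of_small_cost\<close>).  Outside the cube of radius \<open>M\<close> the product measure
  has mass at most \<open>n * exp (- profile M)\<close>; choosing this to be \<open>1/C\<close> makes \<open>M powr \<alpha>\<close> of order
  \<open>ln (n * C)\<close>, which accounts for the power of the logarithm, for the factor \<open>C\<close>, and for the loss of \<open>1/C\<close> in the
  measure of \<open>A\<close>.
\<close>

section \<open>A cost that is quadratic near zero and linear at infinity\<close>

text \<open>
  Quadratic near the origin and linear far away: a smooth stand-in for \<open>min u\<^sup>2 \<bar>u\<bar>\<close>, the
  cost for which the exponential law concentrates.  Smoothness matters because it is
  differentiated below.
\<close>

definition smooth_abs :: "real \<Rightarrow> real" where
  "smooth_abs u = sqrt (1 + u\<^sup>2) - 1"

lemma smooth_abs_nonneg: "0 \<le> smooth_abs u"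
  by (simp add: smooth_abs_def)

lemma smooth_abs_0 [simp]: "smooth_abs 0 = 0"
  by (simp add: smooth_abs_def)

lemma smooth_abs_DERIV: "(smooth_abs has_real_derivative u / sqrt (1 + u\<^sup>2)) (at u)"
proof -
  have "1 + u\<^sup>2 > 0" by (simp add: add_pos_nonneg)
  then show ?thesis
    unfolding smooth_abs_def by (auto intro!: derivative_eq_intros simp: field_simps)
qed

lemma smooth_abs_lipschitz: "\<bar>smooth_abs u - smooth_abs v\<bar> \<le> \<bar>u - v\<bar>"
proof -
  have "sqrt (1\<^sup>2 + u\<^sup>2) \<le> sqrt (1\<^sup>2 + v\<^sup>2) + \<bar>u - v\<bar>" for u v :: real
    using real_sqrt_sum_squares_triangle_ineq[of 1 0 v "u - v"] by simp
  from this[of u v] this[of v u] show ?thesis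
    unfolding smooth_abs_def by auto
qed

section \<open>A nonlinear midpoint for the exponential density\<close>

text \<open>
  This is the pointwise inequality behind the one-dimensional transport estimate.  With
  \<open>\<phi> = smooth_abs / 8\<close> the right-hand side is \<open>1 - 4 \<phi>'\<^sup>2\<close>, which is four times the product of the
  partial derivatives \<open>1/2 - \<phi>'\<close> and \<open>1/2 + \<phi>'\<close> of the midpoint \<open>(x + y)/2 - \<phi> (x - y)\<close>; the
  left-hand side is \<open>exp (w - 2 \<phi>)\<close> for the cost \<open>w = smooth_abs / 10\<close>.  That \<open>w\<close> is well
  below \<open>2 \<phi> = smooth_abs / 4\<close> leaves the room needed for the loss \<open>4 \<phi>'\<^sup>2\<close>, which is of the same
  order as \<open>\<phi>\<close> near the origin.
\<close>

lemma smooth_abs_jacobian: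
  "exp (smooth_abs u / 10 - smooth_abs u / 4) \<le> 1 - 4 * ((u / sqrt (1 + u\<^sup>2)) / 8)\<^sup>2"
proof -
  define s where "s = sqrt (1 + u\<^sup>2)"
  have s: "s \<ge> 1" "s\<^sup>2 = 1 + u\<^sup>2" by (auto simp: s_def add_nonneg_nonneg)
  define q where "q = (s\<^sup>2 - 1) / (16 * s\<^sup>2)"
  have q: "4 * ((u / sqrt (1 + u\<^sup>2)) / 8)\<^sup>2 = q"
  proof -
    have "4 * ((u / s) / 8)\<^sup>2 = u\<^sup>2 / (16 * s\<^sup>2)"
      by (simp add: power_divide)
    then show ?thesis using s(2) by (simp add: q_def s_def[symmetric])
  qed
  define x where "x = 3 / 20 * (s - 1)"
  have x0: "x \<ge> 0" using s by (simp add: x_def)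
  have q1: "q \<le> 1 / 16" using s(1) unfolding q_def by (subst pos_divide_le_eq) auto
  have "q \<le> (s - 1) / 8"
  proof -
    have "s + 1 \<le> 2 * s\<^sup>2" using self_le_power[OF s(1), of 2] s(1) by simp
    then have "(s - 1) * (s + 1) \<le> (s - 1) * (2 * s\<^sup>2)"
      using s(1) by (intro mult_left_mono) auto
    then have "s\<^sup>2 - 1 \<le> (s - 1) / 8 * (16 * s\<^sup>2)"
      by (simp add: power2_eq_square algebra_simps)
    then show ?thesis unfolding q_def using s(1) by (subst pos_divide_le_eq) auto
  qed
  moreover have "x * (1 - q) \<ge> x * (15 / 16)" using q1 x0 by (intro mult_left_mono) auto
  moreover have "(s - 1) / 8 \<le> x * (15 / 16)" using s(1) by (simp add: x_def)
  moreover have "(1 - q) * (1 + x) = 1 + (x * (1 - q) - q)" by (simp add: algebra_simps)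
  ultimately have "(1 - q) * (1 + x) \<ge> 1" by linarith
  then have "1 \<le> (1 - q) * exp x"
    using mult_left_mono[OF exp_ge_add_one_self[of x], of "1 - q"] q1 by linarith
  then have "exp (- x) \<le> 1 - q"
    by (simp add: exp_minus divide_simps)
  then show ?thesis
    unfolding q by (simp add: x_def smooth_abs_def s_def algebra_simps)
qed

text \<open>
  The arithmetic mean has partial derivatives 1/2 and 1/2, but it gives no gain against the density
  \<open>exp (- x)\<close>, which is only log-affine.  Moving the mean towards the origin gains a factor
  \<open>exp (smooth_abs / 8)\<close> in the density, and the product of the partial
  derivatives drops only from 1/4 to \<open>(1 - 4 \<phi>'\<^sup>2) / 4\<close>, where \<open>\<phi> = smooth_abs / 8\<close>.
\<close>

definition shifted_mean :: "real \<Rightarrow> real \<Rightarrow> real" where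
  "shifted_mean x y = (x + y) / 2 - smooth_abs (x - y) / 8"

text \<open>
  The mean value theorem for \<open>smooth_abs\<close>, followed by the inequality between the arithmetic and
  the geometric mean of the two increments \<open>(1/2 - p) (b - a)\<close> and \<open>(1/2 + p) (d - c)\<close>.
\<close>

lemma shifted_mean_increment:
  assumes "a \<le> b" "c \<le> d"
  obtains \<xi> where "min (a - c) (b - d) \<le> \<xi>" "\<xi> \<le> max (a - c) (b - d)"
    "(shifted_mean b d - shifted_mean a c)\<^sup>2
       \<ge> exp (smooth_abs \<xi> / 10 - smooth_abs \<xi> / 4) * ((b - a) * (d - c))"
    "shifted_mean b d - shifted_mean a c \<ge> 0"
proof -
  have "\<exists>\<xi>. min (a - c) (b - d) \<le> \<xi> \<and> \<xi> \<le> max (a - c) (b - d) \<and>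
          smooth_abs (b - d) - smooth_abs (a - c) = ((b - d) - (a - c)) * (\<xi> / sqrt (1 + \<xi>\<^sup>2))"
  proof (cases "a - c" "b - d" rule: linorder_cases)
    case less
    from MVT2[OF less, of smooth_abs "\<lambda>u. u / sqrt (1 + u\<^sup>2)"] smooth_abs_DERIV
    obtain z where "a - c < z" "z < b - d"
      "smooth_abs (b - d) - smooth_abs (a - c) = ((b - d) - (a - c)) * (z / sqrt (1 + z\<^sup>2))" by blast
    then show ?thesis by (intro exI[of _ z]) auto
  next
    case equal then show ?thesis by auto
  next
    case greater
    from MVT2[OF greater, of smooth_abs "\<lambda>u. u / sqrt (1 + u\<^sup>2)"] smooth_abs_DERIV
    obtain z where "b - d < z" "z < a - c" 
      "smooth_abs (a - c) - smooth_abs (b - d) = ((a - c) - (b - d)) * (z / sqrt (1 + z\<^sup>2))" by blast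
    moreover from this(3) have "smooth_abs (b - d) - smooth_abs (a - c) = - (((a - c) - (b - d)) * (z / sqrt (1 + z\<^sup>2)))"
      by linarith
    then have "smooth_abs (b - d) - smooth_abs (a - c) = ((b - d) - (a - c)) * (z / sqrt (1 + z\<^sup>2))"
      by (simp only: mult_minus_left[symmetric] minus_diff_eq)
    ultimately show ?thesis by (intro exI[of _ z]) auto
  qed
  then obtain \<xi> where \<xi>: "min (a - c) (b - d) \<le> \<xi>" "\<xi> \<le> max (a - c) (b - d)"
     "smooth_abs (b - d) - smooth_abs (a - c) = ((b - d) - (a - c)) * (\<xi> / sqrt (1 + \<xi>\<^sup>2))" by blast
  define p where "p = (\<xi> / sqrt (1 + \<xi>\<^sup>2)) / 8"
  define X where "X = b - a"
  define Y where "Y = d - c"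
  have XY: "X \<ge> 0" "Y \<ge> 0" using assms by (auto simp: X_def Y_def)
  have j: "exp (smooth_abs \<xi> / 10 - smooth_abs \<xi> / 4) \<le> 1 - 4 * p\<^sup>2"
    using smooth_abs_jacobian[of \<xi>] by (simp add: p_def)
  have m: "shifted_mean b d - shifted_mean a c = (1 / 2 - p) * X + (1 / 2 + p) * Y"
  proof -
    have "smooth_abs (b - d) = smooth_abs (a - c) + ((b - d) - (a - c)) * (8 * p)"
      using \<xi>(3) by (simp add: p_def)
    then show ?thesis by (simp add: shifted_mean_def X_def Y_def field_simps)
  qed
  have "0 < 1 - 4 * p\<^sup>2" using j exp_gt_zero less_le_trans by blast
  then have "(2 * p)\<^sup>2 < 1" by (simp add: power_mult_distrib)
  then have p: "\<bar>2 * p\<bar> < 1" by (simp only: abs_square_less_1)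
  have "((1 / 2 - p) * X + (1 / 2 + p) * Y)\<^sup>2 - (1 - 4 * p\<^sup>2) * (X * Y)
      = ((1 / 2 - p) * X - (1 / 2 + p) * Y)\<^sup>2"
    by (simp add: power2_eq_square algebra_simps)
  then have "(1 - 4 * p\<^sup>2) * (X * Y) \<le> ((1 / 2 - p) * X + (1 / 2 + p) * Y)\<^sup>2"
    by (smt (verit) zero_le_power2)
  moreover have "exp (smooth_abs \<xi> / 10 - smooth_abs \<xi> / 4) * (X * Y) \<le> (1 - 4 * p\<^sup>2) * (X * Y)"
    using j XY by (intro mult_right_mono) auto
  ultimately have 1: "exp (smooth_abs \<xi> / 10 - smooth_abs \<xi> / 4) * (X * Y) 
     \<le> (shifted_mean b d - shifted_mean a c)\<^sup>2" by (simp add: m)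
  have 2: "shifted_mean b d - shifted_mean a c \<ge> 0" 
  proof -
    have "1 / 2 - p \<ge> 0" "1 / 2 + p \<ge> 0" using p by linarith+
    then show ?thesis unfolding m using XY by simp
  qed
  from that[OF \<xi>(1,2) 1[unfolded X_def Y_def] 2] show thesis .
qed

section \<open>Transport of mass on the half-line\<close>

text \<open>
  The quantile function \<open>s\<close> of the normalized density \<open>f\<close>.  The lower bound on \<open>f\<close> makes it
  Lipschitz, so that short pieces of \<open>[0, 1]\<close> correspond to short intervals.
\<close>

lemma mass_parametrization:
  fixes f :: "real \<Rightarrow> real"
  assumes "N > 0" "\<delta> > 0" and int: "f integrable_on {0..N}" and ge: "\<And>x. x \<in> {0..N} \<Longrightarrow> \<delta> \<le> f x"
  obtains s L where "s 0 = 0" "s 1 = N" "L > 0"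
    "\<And>t u. 0 \<le> t \<Longrightarrow> t \<le> u \<Longrightarrow> u \<le> 1 \<Longrightarrow> 0 \<le> s t \<and> s t \<le> s u \<and> s u \<le> N"
    "\<And>t u. 0 \<le> t \<Longrightarrow> t \<le> u \<Longrightarrow> u \<le> 1 \<Longrightarrow> s u - s t \<le> L * (u - t)"
    "\<And>t u. 0 \<le> t \<Longrightarrow> t \<le> u \<Longrightarrow> u \<le> 1 \<Longrightarrow> integral {s t..s u} f = (u - t) * integral {0..N} f"
proof -
  define \<Phi> where "\<Phi> x = integral {0..x} f" for x
  define I where "I = integral {0..N} f"
  have cont: "continuous_on {0..N} \<Phi>"
    unfolding \<Phi>_def by (rule indefinite_integral_continuous_1[OF int])
  have diff: "integral {a..b} f = \<Phi> b - \<Phi> a" if "0 \<le> a" "a \<le> b" "b \<le> N" for a b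
    unfolding \<Phi>_def using Henstock_Kurzweil_Integration.integral_combine[OF that(1,2), of f] that
      integrable_on_subinterval[OF int, of 0 b] by auto
  have lower: "\<delta> * (b - a) \<le> \<Phi> b - \<Phi> a" if "0 \<le> a" "a \<le> b" "b \<le> N" for a b
  proof -
    have "integral {a..b} (\<lambda>_. \<delta>) \<le> integral {a..b} f"
      using that by (intro integral_le ge integrable_on_subinterval[OF int]) auto
    then show ?thesis using diff[OF that] that by (simp add: mult.commute)
  qed
  have \<Phi>0: "\<Phi> 0 = 0" and \<Phi>N: "\<Phi> N = I" by (auto simp: \<Phi>_def I_def)
  have I: "I > 0" using lower[of 0 N] \<Phi>0 \<Phi>N assms(1,2) by (smt (verit) mult_pos_pos)
  have "\<exists>x. 0 \<le> x \<and> x \<le> N \<and> \<Phi> x = t * I" if "0 \<le> t" "t \<le> 1" for t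
    using IVT'[of \<Phi> 0 "t * I" N] cont that I \<Phi>0 \<Phi>N assms(1)
    by (auto simp: mult_left_le_one_le)
  then obtain s where s: "\<And>t. 0 \<le> t \<Longrightarrow> t \<le> 1 \<Longrightarrow> 0 \<le> s t \<and> s t \<le> N \<and> \<Phi> (s t) = t * I" by metis
  have inj: "a = b" if "0 \<le> a" "a \<le> N" "0 \<le> b" "b \<le> N" "\<Phi> a = \<Phi> b" for a b
    using lower[of a b] lower[of b a] that \<open>\<delta> > 0\<close> by (smt (verit) mult_pos_pos)
  have mono: "s t \<le> s u" if "0 \<le> t" "t \<le> u" "u \<le> 1" for t u
  proof (rule ccontr)
    assume "\<not> s t \<le> s u"
    then have "\<delta> * (s t - s u) \<le> \<Phi> (s t) - \<Phi> (s u)" "s t - s u > 0" using lower[of "s u" "s t"] s[of t] s[of u] that by auto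
    moreover have "\<Phi> (s t) \<le> \<Phi> (s u)" using s[of t] s[of u] that I by (auto simp: mult_right_mono)
    ultimately show False using \<open>\<delta> > 0\<close> by (smt (verit) mult_pos_pos)
  qed
  show thesis
  proof (rule that[of s "I / \<delta>"])
    show "s 0 = 0" using s[of 0] inj[of "s 0" 0] \<Phi>0 assms(1) by auto
    show "s 1 = N" using s[of 1] inj[of "s 1" N] \<Phi>N assms(1) by auto
    show "I / \<delta> > 0" using I assms by simp
    show "0 \<le> s t \<and> s t \<le> s u \<and> s u \<le> N" if "0 \<le> t" "t \<le> u" "u \<le> 1" for t u
      using s[of t] s[of u] mono that by auto
    show "s u - s t \<le> I / \<delta> * (u - t)" if "0 \<le> t" "t \<le> u" "u \<le> 1" for t u
      using lower[of "s t" "s u"] s[of t] s[of u] mono[of t u] that \<open>\<delta> > 0\<close> by (simp add: field_simps)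
    show "integral {s t..s u} f = (u - t) * integral {0..N} f" if "0 \<le> t" "t \<le> u" "u \<le> 1" for t u
      using diff[of "s t" "s u"] s[of t] s[of u] mono[of t u] that by (simp add: I_def algebra_simps)
  qed
qed

lemma integral_mult_integral_le:
  fixes f g :: "real \<Rightarrow> real"
  assumes "a \<le> b" "c \<le> d" "f integrable_on {a..b}" "g integrable_on {c..d}"
    and "\<And>x y. x \<in> {a..b} \<Longrightarrow> y \<in> {c..d} \<Longrightarrow> f x * g y \<le> Q"
  shows "integral {a..b} f * integral {c..d} g \<le> Q * ((b - a) * (d - c))"
proof -
  have "integral {a..b} f * g y \<le> Q * (b - a)" if y: "y \<in> {c..d}" for y
  proof -
    have "integral {a..b} (\<lambda>x. f x * g y) \<le> integral {a..b} (\<lambda>_. Q)"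
      using assms y by (intro integral_le integrable_on_mult_left) auto
    then show ?thesis using assms(1) by (simp add: mult.commute)
  qed
  then have "integral {c..d} (\<lambda>y. integral {a..b} f * g y) \<le> integral {c..d} (\<lambda>_. Q * (b - a))"
    using assms by (intro integral_le integrable_on_mult_right) auto
  then show ?thesis using assms(2) by (simp add: algebra_simps)
qed

text \<open>
  Let \<open>s\<close> and \<open>r\<close> be the quantile functions of \<open>f\<close> and \<open>g\<close>.  As \<open>t\<close> runs from 0 to 1 the shifted mean
  of \<open>s t\<close> and \<open>r t\<close> runs from 0 to \<open>N\<close>, so the intervals it sweeps have total exponential mass at most 1.
  On a short piece \<open>[t, u]\<close> the product of the masses of \<open>f\<close> and \<open>g\<close> is \<open>(u - t)\<^sup>2\<close> times the product of the
  integrals; the hypothesis on \<open>f x * g y\<close> and the increment of the shifted mean show that the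
  swept mass is at least \<open>(u - t)\<close> times the geometric mean of the integrals, up to a factor close
  to 1.  Both sides of this estimate are additive in \<open>[t, u]\<close>, so Bolzano's bisection principle turns
  the estimate for short pieces into the one for \<open>[0, 1]\<close>.  The bisection replaces
  differentiation of the transport map, whose derivative exists only almost everywhere when \<open>f\<close> and \<open>g\<close>
  are merely integrable.
\<close>

lemma exponential_transport_bounded:
  fixes f g :: "real \<Rightarrow> real"
  assumes "N > 0" "\<delta> > 0" "f integrable_on {0..N}" "g integrable_on {0..N}"
    and "\<And>x. x \<in> {0..N} \<Longrightarrow> \<delta> \<le> f x" "\<And>x. x \<in> {0..N} \<Longrightarrow> \<delta> \<le> g x"
    and fg: "\<And>x y. x \<in> {0..N} \<Longrightarrow> y \<in> {0..N} \<Longrightarrow> f x * g y \<le> exp (smooth_abs (x - y) / 10 - x - y)"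
  shows "integral {0..N} f * integral {0..N} g \<le> 1"
proof -
  obtain s L where s: "s 0 = 0" "s 1 = N" "L > 0"
    "\<And>t u. 0 \<le> t \<Longrightarrow> t \<le> u \<Longrightarrow> u \<le> 1 \<Longrightarrow> 0 \<le> s t \<and> s t \<le> s u \<and> s u \<le> N"
    "\<And>t u. 0 \<le> t \<Longrightarrow> t \<le> u \<Longrightarrow> u \<le> 1 \<Longrightarrow> s u - s t \<le> L * (u - t)"
    "\<And>t u. 0 \<le> t \<Longrightarrow> t \<le> u \<Longrightarrow> u \<le> 1 \<Longrightarrow> integral {s t..s u} f = (u - t) * integral {0..N} f"
    by (rule mass_parametrization[OF assms(1,2,3,5)]) (assumption | blast)+
  obtain r K where r: "r 0 = 0" "r 1 = N" "K > 0"
    "\<And>t u. 0 \<le> t \<Longrightarrow> t \<le> u \<Longrightarrow> u \<le> 1 \<Longrightarrow> 0 \<le> r t \<and> r t \<le> r u \<and> r u \<le> N"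
    "\<And>t u. 0 \<le> t \<Longrightarrow> t \<le> u \<Longrightarrow> u \<le> 1 \<Longrightarrow> r u - r t \<le> K * (u - t)"
    "\<And>t u. 0 \<le> t \<Longrightarrow> t \<le> u \<Longrightarrow> u \<le> 1 \<Longrightarrow> integral {r t..r u} g = (u - t) * integral {0..N} g"
    by (rule mass_parametrization[OF assms(1,2,4,6)]) (assumption | blast)+
  define I where "I = integral {0..N} f"
  define J where "J = integral {0..N} g"
  define E where "E t = exp (- shifted_mean (s t) (r t))" for t
  have IJ: "I \<ge> 0" "J \<ge> 0"
    using assms unfolding I_def J_def by (auto intro!: integral_nonneg intro: order.trans less_imp_le)
  have main: "sqrt (I * J) \<le> exp (5 * \<eta>)" if \<eta>: "\<eta> > 0" for \<eta>
  proof -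
    let ?P = "\<lambda>t u. 0 \<le> t \<and> u \<le> 1 \<longrightarrow> (u - t) * sqrt (I * J) \<le> exp (5 * \<eta>) * (E t - E u)"
    have "?P 0 1"
    proof (rule Bolzano[of 0 1 ?P])
      show "(0::real) \<le> 1" by simp
      fix t u v :: real assume "?P t u" "?P u v" "t \<le> u" "u \<le> v"
      then show "?P t v" by (auto simp: algebra_simps)
    next
      fix x :: real
      show "\<exists>d>0. \<forall>t u. t \<le> x \<and> x \<le> u \<and> u - t < d \<longrightarrow> ?P t u"
      proof (intro exI[of _ "\<eta> / (L + K)"] conjI allI impI; (elim conjE)?)
        show "\<eta> / (L + K) > 0" using \<eta> s(3) r(3) by simp
        fix t u assume tu: "t \<le> x" "x \<le> u" "u - t < \<eta> / (L + K)" "0 \<le> t" "u \<le> 1"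
        have tu': "0 \<le> t" "t \<le> u" "u \<le> 1" using tu by auto
        define a b c d where abcd: "a = s t" "b = s u" "c = r t" "d = r u"
        have ord: "0 \<le> a" "a \<le> b" "b \<le> N" "0 \<le> c" "c \<le> d" "d \<le> N"
          using s(4)[OF tu'] r(4)[OF tu'] by (auto simp: abcd)
        have "(L + K) * (u - t) < \<eta>" using tu(3) s(3) r(3) by (simp add: field_simps)
        moreover have "b - a \<le> L * (u - t)" "d - c \<le> K * (u - t)"
          using s(5)[OF tu'] r(5)[OF tu'] by (auto simp: abcd)
        moreover have "L * (u - t) \<ge> 0" "K * (u - t) \<ge> 0" using s(3) r(3) tu' by auto
        ultimately have small: "b - a \<le> \<eta>" "d - c \<le> \<eta>" by (auto simp: algebra_simps)
        (* Both sub-intervals have length at most \<eta>, so replacing x, y and x - y by b, d and \<xi>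
           changes the exponents below by at most a fixed multiple of \<eta>. *)
        obtain \<xi> where \<xi>: "min (a - c) (b - d) \<le> \<xi>" "\<xi> \<le> max (a - c) (b - d)"
          "(shifted_mean b d - shifted_mean a c)\<^sup>2
              \<ge> exp (smooth_abs \<xi> / 10 - smooth_abs \<xi> / 4) * ((b - a) * (d - c))"
          "shifted_mean b d - shifted_mean a c \<ge> 0"
          using shifted_mean_increment[OF ord(2,5)] by blast
        define S where "S = smooth_abs \<xi>"
        define Q where "Q = exp (S / 10 - b - d + 3 * \<eta>)"
        have close: "\<bar>smooth_abs v - S\<bar> \<le> 2 * \<eta>" if "\<bar>v - \<xi>\<bar> \<le> 2 * \<eta>" for v
          using smooth_abs_lipschitz[of v \<xi>] that by (simp add: S_def)
        have "integral {a..b} f * integral {c..d} g \<le> Q * ((b - a) * (d - c))"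
        proof (rule integral_mult_integral_le[OF ord(2,5)])
          show "f integrable_on {a..b}" "g integrable_on {c..d}"
            using ord by (auto intro: integrable_on_subinterval[OF assms(3)] integrable_on_subinterval[OF assms(4)])
          fix x y assume xy: "x \<in> {a..b}" "y \<in> {c..d}"
          have "\<bar>(x - y) - \<xi>\<bar> \<le> 2 * \<eta>" using xy \<xi>(1,2) small by (auto simp: min_def max_def split: if_splits)
          from close[OF this] have "smooth_abs (x - y) / 10 - x - y \<le> S / 10 - b - d + 3 * \<eta>"
            using xy small by (auto simp: field_simps)
          then show "f x * g y \<le> Q"
            using fg[of x y] xy ord unfolding Q_def by (smt (verit) atLeastAtMost_iff exp_le_cancel_iff)
        qed
        moreover have "integral {a..b} f * integral {c..d} g = (u - t)\<^sup>2 * (I * J)"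
          using s(6)[OF tu'] r(6)[OF tu'] by (simp add: abcd I_def J_def power2_eq_square)
        ultimately have 1: "(u - t)\<^sup>2 * (I * J) \<le> Q * ((b - a) * (d - c))" by simp
        define m where "m = shifted_mean b d"
        define D where "D = shifted_mean b d - shifted_mean a c"
        have "\<bar>(b - d) - \<xi>\<bar> \<le> 2 * \<eta>" using \<xi>(1,2) small ord by (auto simp: min_def max_def split: if_splits)
        from close[OF this] have mle: "2 * m \<le> b + d - S / 4 + \<eta>"
          by (auto simp: m_def shifted_mean_def field_simps)
        have "Q * ((b - a) * (d - c)) \<le> (exp (5 * \<eta> - m) * D)\<^sup>2"
        proof -
          have "Q = exp (S / 4 - b - d + 3 * \<eta>) * exp (S / 10 - S / 4)"
            by (simp add: Q_def flip: exp_add)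
          then have "Q * ((b - a) * (d - c)) = exp (S / 4 - b - d + 3 * \<eta>) * (exp (S / 10 - S / 4) * ((b - a) * (d - c)))"
            by simp
          also have "\<dots> \<le> exp (2 * (5 * \<eta> - m)) * D\<^sup>2"
            using \<xi>(3) mle \<eta> ord unfolding S_def D_def
            by (intro mult_mono) auto
          finally show ?thesis by (simp only: power_mult_distrib exp_double)
        qed
        with 1 have sq: "((u - t) * sqrt (I * J))\<^sup>2 \<le> (exp (5 * \<eta> - m) * D)\<^sup>2"
          using IJ by (simp add: power_mult_distrib)
        have "(u - t) * sqrt (I * J) \<le> exp (5 * \<eta> - m) * D"
          by (rule power2_le_imp_le[OF sq]) (use \<xi>(4) in \<open>simp add: D_def\<close>)
        also have "\<dots> = exp (5 * \<eta>) * (exp (- m) * D)" by (simp add: exp_diff exp_minus divide_simps)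
        also have "exp (- m) * D \<le> exp (- m) * (exp D - 1)"
          using exp_ge_add_one_self[of D] by (intro mult_left_mono) (simp_all add: algebra_simps)
        also have "\<dots> = E t - E u"
          by (simp add: E_def m_def D_def abcd right_diff_distrib flip: exp_add)
        finally show "(u - t) * sqrt (I * J) \<le> exp (5 * \<eta>) * (E t - E u)" by simp
      qed
    qed
    then have "sqrt (I * J) \<le> exp (5 * \<eta>) * (E 0 - E 1)" by simp
    also have "\<dots> \<le> exp (5 * \<eta>) * 1"
      by (intro mult_left_mono) (auto simp: E_def s r shifted_mean_def)
    finally show ?thesis by simp
  qed
  have "((\<lambda>\<eta>. exp (5 * \<eta>)) \<longlongrightarrow> exp (5 * 0)) (at_right (0::real))" by (intro tendsto_intros)
  moreover have "eventually (\<lambda>\<eta>. sqrt (I * J) \<le> exp (5 * \<eta>)) (at_right 0)"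
    using main by (auto simp: eventually_at_filter)
  ultimately have "sqrt (I * J) \<le> exp (5 * 0)" by (rule tendsto_lowerbound) simp
  then show ?thesis by (simp add: I_def J_def)
qed

section \<open>The transport property and its permanence\<close>

text \<open>
  Maurey's infimum-convolution property for the cost \<open>c\<close>, with \<open>F = exp (Q f)\<close> and \<open>G = exp (- f)\<close>
  decoupled.  In this two-function form no infimum over uncountably many points has to be measurable,
  and the property passes to products by integrating one coordinate at a time.
\<close>

definition transport_property :: "'a measure \<Rightarrow> ('a \<Rightarrow> 'a \<Rightarrow> real) \<Rightarrow> bool" where
  "transport_property M c \<longleftrightarrow>
     (\<forall>F\<in>borel_measurable M. \<forall>G\<in>borel_measurable M.
        (\<forall>x\<in>space M. \<forall>y\<in>space M. F x * G y \<le> ennreal (exp (c x y))) \<longrightarrow>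
        (\<integral>\<^sup>+x. F x \<partial>M) * (\<integral>\<^sup>+x. G x \<partial>M) \<le> 1)"

lemma transport_propertyI:
  assumes "\<And>F G. F \<in> borel_measurable M \<Longrightarrow> G \<in> borel_measurable M \<Longrightarrow>
     (\<And>x y. x \<in> space M \<Longrightarrow> y \<in> space M \<Longrightarrow> F x * G y \<le> ennreal (exp (c x y))) \<Longrightarrow>
     (\<integral>\<^sup>+x. F x \<partial>M) * (\<integral>\<^sup>+x. G x \<partial>M) \<le> 1"
  shows "transport_property M c"
  using assms unfolding transport_property_def by blast

lemma transport_propertyD:
  assumes "transport_property M c" "F \<in> borel_measurable M" "G \<in> borel_measurable M"
    "\<And>x y. x \<in> space M \<Longrightarrow> y \<in> space M \<Longrightarrow> F x * G y \<le> ennreal (exp (c x y))"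
  shows "(\<integral>\<^sup>+x. F x \<partial>M) * (\<integral>\<^sup>+x. G x \<partial>M) \<le> 1"
  using assms unfolding transport_property_def by blast

text \<open>
  The form used in tensorization: \<open>b\<close> is the cost already paid in the coordinates that are held
  fixed.
\<close>

lemma transport_property_scaled:
  assumes M: "transport_property M c" and [measurable]: "F \<in> borel_measurable M" "G \<in> borel_measurable M"
    and FG: "\<And>x y. x \<in> space M \<Longrightarrow> y \<in> space M \<Longrightarrow> F x * G y \<le> ennreal (exp (b + c x y))"
  shows "(\<integral>\<^sup>+x. F x \<partial>M) * (\<integral>\<^sup>+x. G x \<partial>M) \<le> ennreal (exp b)"
proof -
  have e: "ennreal (exp b) * ennreal (exp (- b)) = 1"
    by (simp add: ennreal_mult[symmetric] flip: exp_add)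
  have "(\<integral>\<^sup>+x. ennreal (exp (- b)) * F x \<partial>M) * (\<integral>\<^sup>+x. G x \<partial>M) \<le> 1"
  proof (rule transport_propertyD[OF M])
    fix x y assume "x \<in> space M" "y \<in> space M"
    then have "ennreal (exp (- b)) * (F x * G y) \<le> ennreal (exp (- b)) * ennreal (exp (b + c x y))"
      using FG by (intro mult_left_mono) auto
    also have "\<dots> = ennreal (exp (c x y))" by (simp add: ennreal_mult[symmetric] flip: exp_add)
    finally show "ennreal (exp (- b)) * F x * G y \<le> ennreal (exp (c x y))" by (simp add: mult.assoc)
  qed measurable
  then have "ennreal (exp (- b)) * ((\<integral>\<^sup>+x. F x \<partial>M) * (\<integral>\<^sup>+x. G x \<partial>M)) \<le> 1"
    by (simp add: nn_integral_cmult mult.assoc)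
  then have "ennreal (exp b) * (ennreal (exp (- b)) * ((\<integral>\<^sup>+x. F x \<partial>M) * (\<integral>\<^sup>+x. G x \<partial>M))) \<le> ennreal (exp b) * 1"
    by (rule mult_left_mono) simp
  then show ?thesis by (simp only: mult.assoc[symmetric] e) simp
qed

text \<open>
  Apply the property to \<open>exp t\<close> times the indicator of \<open>A\<close> and to the indicator of \<open>B\<close>.
\<close>

lemma transport_property_separated:
  assumes "finite_measure M" and M: "transport_property M c" and [measurable]: "A \<in> sets M" "B \<in> sets M"
    and sep: "\<And>x y. x \<in> A \<Longrightarrow> y \<in> B \<Longrightarrow> t \<le> c x y"
  shows "measure M A * measure M B \<le> exp (- t)"
proof -
  interpret finite_measure M by fact
  have "(\<integral>\<^sup>+x. ennreal (exp t) * indicator A x \<partial>M) * (\<integral>\<^sup>+x. indicator B x \<partial>M) \<le> 1"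
    using sep by (intro transport_propertyD[OF M]) (auto simp: indicator_def ennreal_leI)
  then have "ennreal (exp t * measure M A * measure M B) \<le> 1"
    by (simp add: nn_integral_cmult emeasure_eq_measure ennreal_mult)
  then show ?thesis by (simp add: ennreal_le_1 exp_minus field_simps)
qed

lemma transport_property_image:
  assumes M: "transport_property M c" and h[measurable]: "h \<in> measurable M N"
    and le: "\<And>x y. x \<in> space M \<Longrightarrow> y \<in> space M \<Longrightarrow> c' (h x) (h y) \<le> c x y"
  shows "transport_property (distr M N h) c'"
proof (rule transport_propertyI)
  fix F G :: "'b \<Rightarrow> ennreal" assume "F \<in> borel_measurable (distr M N h)" "G \<in> borel_measurable (distr M N h)"
  then have [measurable]: "F \<in> borel_measurable N" "G \<in> borel_measurable N" by auto
  assume FG: "\<And>x y. x \<in> space (distr M N h) \<Longrightarrow> y \<in> space (distr M N h) \<Longrightarrow> F x * G y \<le> ennreal (exp (c' x y))"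
  have "(\<integral>\<^sup>+x. F (h x) \<partial>M) * (\<integral>\<^sup>+x. G (h x) \<partial>M) \<le> 1"
  proof (rule transport_propertyD[OF M])
    fix x y assume "x \<in> space M" "y \<in> space M"
    then show "F (h x) * G (h y) \<le> ennreal (exp (c x y))"
      using FG[of "h x" "h y"] le[of x y] measurable_space[OF h]
      by (auto intro: order.trans simp: ennreal_leI)
  qed measurable
  then show "(\<integral>\<^sup>+x. F x \<partial>distr M N h) * (\<integral>\<^sup>+x. G x \<partial>distr M N h) \<le> 1"
    by (simp add: nn_integral_distr)
qed

text \<open>
  The sections of \<open>F\<close> and \<open>G\<close> over fixed first coordinates satisfy the hypothesis for \<open>M2\<close> up to the factor
  \<open>exp c1\<close>, so their integrals satisfy the hypothesis for \<open>M1\<close>.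
\<close>

lemma transport_property_pair:
  assumes "sigma_finite_measure M2"
    and 1: "transport_property M1 c1" and 2: "transport_property M2 c2"
  shows "transport_property (M1 \<Otimes>\<^sub>M M2) (\<lambda>x y. c1 (fst x) (fst y) + c2 (snd x) (snd y))"
proof (rule transport_propertyI)
  interpret sigma_finite_measure M2 by fact
  fix F G :: "'b \<times> 'a \<Rightarrow> ennreal"
  assume [measurable]: "F \<in> borel_measurable (M1 \<Otimes>\<^sub>M M2)" "G \<in> borel_measurable (M1 \<Otimes>\<^sub>M M2)"
  assume FG: "\<And>x y. x \<in> space (M1 \<Otimes>\<^sub>M M2) \<Longrightarrow> y \<in> space (M1 \<Otimes>\<^sub>M M2) \<Longrightarrow>
    F x * G y \<le> ennreal (exp (c1 (fst x) (fst y) + c2 (snd x) (snd y)))"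
  have "(\<integral>\<^sup>+x. (\<integral>\<^sup>+x'. F (x, x') \<partial>M2) \<partial>M1) * (\<integral>\<^sup>+y. (\<integral>\<^sup>+y'. G (y, y') \<partial>M2) \<partial>M1) \<le> 1"
  proof (rule transport_propertyD[OF 1])
    fix x y assume xy: "x \<in> space M1" "y \<in> space M1"
    show "(\<integral>\<^sup>+x'. F (x, x') \<partial>M2) * (\<integral>\<^sup>+y'. G (y, y') \<partial>M2) \<le> ennreal (exp (c1 x y))"
      using xy FG[of "(x, _)" "(y, _)"] by (intro transport_property_scaled[OF 2]) (auto simp: space_pair_measure)
  qed measurable
  then show "integral\<^sup>N (M1 \<Otimes>\<^sub>M M2) F * integral\<^sup>N (M1 \<Otimes>\<^sub>M M2) G \<le> 1"
    by (simp add: nn_integral_fst)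
qed

lemma transport_property_PiM:
  assumes "\<And>i. sigma_finite_measure (M i)" and "finite I"
    and c: "\<And>i. i \<in> I \<Longrightarrow> transport_property (M i) (c i)"
  shows "transport_property (PiM I M) (\<lambda>x y. \<Sum>i\<in>I. c i (x i) (y i))"
  using assms(2) c
proof (induction rule: finite_induct)
  case empty
  then show ?case
    by (auto intro!: transport_propertyI simp: PiM_empty nn_integral_count_space_finite)
next
  case (insert i I)
  interpret product_sigma_finite M using assms(1) by (simp add: product_sigma_finite_def)
  show ?case
  proof (rule transport_propertyI)
    fix F G :: "('a \<Rightarrow> 'b) \<Rightarrow> ennreal"
    assume [measurable]: "F \<in> borel_measurable (PiM (insert i I) M)" "G \<in> borel_measurable (PiM (insert i I) M)"
    assume FG: "\<And>x y. x \<in> space (PiM (insert i I) M) \<Longrightarrow> y \<in> space (PiM (insert i I) M) \<Longrightarrow>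
      F x * G y \<le> ennreal (exp (\<Sum>j\<in>insert i I. c j (x j) (y j)))"
    interpret sigma_finite_measure "M i" by (rule assms(1))
    have section_measurable: "(\<lambda>x. \<integral>\<^sup>+a. H (x(i := a)) \<partial>M i) \<in> borel_measurable (PiM I M)"
      if "H \<in> borel_measurable (PiM (insert i I) M)" for H :: "('a \<Rightarrow> 'b) \<Rightarrow> ennreal"
      using measurable_compose[OF measurable_add_dim that]
      by (intro borel_measurable_nn_integral) (simp add: case_prod_unfold)
    have "(\<integral>\<^sup>+x. (\<integral>\<^sup>+a. F (x(i := a)) \<partial>M i) \<partial>PiM I M) * (\<integral>\<^sup>+x. (\<integral>\<^sup>+a. G (x(i := a)) \<partial>M i) \<partial>PiM I M) \<le> 1"
    proof (rule transport_propertyD[OF insert.IH])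
      fix x y assume [measurable]: "x \<in> space (PiM I M)" "y \<in> space (PiM I M)"
      show "(\<integral>\<^sup>+a. F (x(i := a)) \<partial>M i) * (\<integral>\<^sup>+a. G (y(i := a)) \<partial>M i)
          \<le> ennreal (exp (\<Sum>j\<in>I. c j (x j) (y j)))"
      proof (rule transport_property_scaled[where c = "c i"])
        show "transport_property (M i) (c i)" using insert.prems by simp
        fix a b assume ab: "a \<in> space (M i)" "b \<in> space (M i)"
        have "(\<Sum>j\<in>I. c j ((x(i := a)) j) ((y(i := b)) j)) = (\<Sum>j\<in>I. c j (x j) (y j))"
          using insert.hyps by (intro sum.cong) auto
        moreover have "x(i := a) \<in> space (PiM (insert i I) M)" "y(i := b) \<in> space (PiM (insert i I) M)"
          using ab \<open>x \<in> _\<close> \<open>y \<in> _\<close> by (auto simp: space_PiM PiE_fun_upd)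
        ultimately show "F (x(i := a)) * G (y(i := b)) \<le> ennreal (exp ((\<Sum>j\<in>I. c j (x j) (y j)) + c i a b))"
          using FG[of "x(i := a)" "y(i := b)"] insert.hyps by (simp add: add.commute)
      qed measurable
    qed (use insert.prems section_measurable in auto)
    then show "integral\<^sup>N (PiM (insert i I) M) F * integral\<^sup>N (PiM (insert i I) M) G \<le> 1"
      using insert.hyps by (simp add: product_nn_integral_insert)
  qed
qed

section \<open>The one-sided exponential law\<close>

abbreviation exponential :: "real measure" where
  "exponential \<equiv> density lborel (exponential_density 1)"

lemma nn_integral_exponential_truncated:
  fixes F :: "real \<Rightarrow> ennreal"
  assumes [measurable]: "F \<in> borel_measurable borel" and "\<And>x. F x \<le> ennreal B" "0 \<le> N"
  defines "f \<equiv> \<lambda>x. enn2real (F x) * exp (- x)"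
  shows "f integrable_on {0..N}"
    and "(\<integral>\<^sup>+x. F x * indicator {..N} x \<partial>exponential) = ennreal (integral {0..N} f)"
proof -
  have fin: "F x < \<top>" for x using assms(2)[of x] by (simp add: order.strict_trans1)
  have le: "enn2real (F x) \<le> \<bar>B\<bar>" for x
  proof -
    have "enn2real (F x) \<le> enn2real (ennreal \<bar>B\<bar>)"
      using assms(2)[of x] by (intro enn2real_mono) (auto intro: order.trans simp: ennreal_leI)
    then show ?thesis by simp
  qed
  have [measurable]: "f \<in> borel_measurable borel" unfolding f_def by measurable
  have int: "set_integrable lborel {0..N} f"
    unfolding set_integrable_def
  proof (rule Bochner_Integration.integrable_bound)
    show "integrable lborel (\<lambda>x. indicator {0..N} x *\<^sub>R \<bar>B\<bar>)" by (simp add: assms(3))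
    show "AE x in lborel. norm (indicator {0..N} x *\<^sub>R f x) \<le> norm (indicator {0..N} x *\<^sub>R \<bar>B\<bar>)"
      using le by (intro AE_I2) (auto simp: indicator_def f_def abs_mult intro!: mult_mono' [of _ "\<bar>B\<bar>" _ 1, simplified])
  qed measurable
  then show "f integrable_on {0..N}" by (rule set_borel_integral_eq_integral)
  have "(\<integral>\<^sup>+x. F x * indicator {..N} x \<partial>exponential)
      = (\<integral>\<^sup>+x. ennreal (exponential_density 1 x) * (F x * indicator {..N} x) \<partial>lborel)"
    by (subst nn_integral_density) auto
  also have "\<dots> = (\<integral>\<^sup>+x. ennreal (indicator {0..N} x *\<^sub>R f x) \<partial>lborel)"
    using fin by (intro nn_integral_cong)
      (auto simp: exponential_density_def indicator_def f_def ennreal_mult mult.commute ennreal_enn2real)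
  also have "\<dots> = ennreal (\<integral>x. indicator {0..N} x *\<^sub>R f x \<partial>lborel)"
    using int unfolding set_integrable_def by (intro nn_integral_eq_integral) (auto simp: f_def)
  also have "\<dots> = ennreal (integral {0..N} f)"
    using set_borel_integral_eq_integral(2)[OF int] by (simp add: set_lebesgue_integral_def)
  finally show "(\<integral>\<^sup>+x. F x * indicator {..N} x \<partial>exponential) = ennreal (integral {0..N} f)" .
qed

text \<open>
  Bounds from above and below are imposed at once: replacing \<open>F\<close> and \<open>G\<close> by their truncations to
  \<open>[1/B, B]\<close> keeps the hypothesis, because every product that involves a lower bound \<open>1/B\<close> is at
  most 1 and the cost is nonnegative.
\<close>

lemma exponential_transport_truncated:
  fixes F G :: "real \<Rightarrow> ennreal"
  assumes [measurable]: "F \<in> borel_measurable borel" "G \<in> borel_measurable borel"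
    and FG: "\<And>x y. F x * G y \<le> ennreal (exp (smooth_abs (x - y) / 10))" and "B \<ge> 1"
  shows "(\<integral>\<^sup>+x. min (F x) (ennreal B) * indicator {..B} x \<partial>exponential)
       * (\<integral>\<^sup>+x. min (G x) (ennreal B) * indicator {..B} x \<partial>exponential) \<le> 1"
proof -
  define T where "T H x = max (min (H x) (ennreal B)) (ennreal (1 / B))" for H :: "real \<Rightarrow> ennreal" and x
  have [measurable]: "T H \<in> borel_measurable borel" if [measurable]: "H \<in> borel_measurable borel" for H
    unfolding T_def by measurable
  have B: "1 / B \<le> B"
  proof -
    have "1 / B \<le> 1" using \<open>B \<ge> 1\<close> by simp
    then show ?thesis using \<open>B \<ge> 1\<close> by linarith
  qed
  have TB: "T H x \<le> ennreal B" for H x using B by (auto simp: T_def ennreal_leI)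
  have T1: "ennreal (1 / B) \<le> T H x" for H x by (simp add: T_def)
  have TT: "T F x * T G y \<le> ennreal (exp (smooth_abs (x - y) / 10))" for x y
  proof -
    have ge1: "1 \<le> ennreal (exp (smooth_abs (x - y) / 10))" using smooth_abs_nonneg by simp
    have *: "ennreal (1 / B) * min h (ennreal B) \<le> 1" for h
    proof -
      have "ennreal (1 / B) * min h (ennreal B) \<le> ennreal (1 / B) * ennreal B" by (intro mult_left_mono) auto
      also have "\<dots> = 1" using \<open>B \<ge> 1\<close> by (simp flip: ennreal_mult)
      finally show ?thesis .
    qed
    have **: "ennreal (1 / B) * ennreal (1 / B) \<le> 1"
      using \<open>B \<ge> 1\<close> by (intro mult_le_one) (auto simp: divide_le_eq)
    have "min (F x) (ennreal B) * min (G y) (ennreal B) \<le> F x * G y"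
      by (intro mult_mono) auto
    then have "min (F x) (ennreal B) * min (G y) (ennreal B) \<le> ennreal (exp (smooth_abs (x - y) / 10))"
      using FG order.trans by blast
    then show ?thesis
      unfolding T_def max_def using *[of "F x"] *[of "G y"] ** ge1 by (auto simp: mult.commute intro: order.trans)
  qed
  define f where "f H x = enn2real (T H x) * exp (- x)" for H x
  have low: "1 / B \<le> enn2real (T H x)" for H x
    using enn2real_mono[OF T1[of H x]] TB[of H x] \<open>B \<ge> 1\<close> by (simp add: order.strict_trans1)
  have f_int: "f F integrable_on {0..B}" "f G integrable_on {0..B}"
    using nn_integral_exponential_truncated(1)[of "T F" B B] nn_integral_exponential_truncated(1)[of "T G" B B]
      TB \<open>B \<ge> 1\<close>
    by (auto simp: f_def[abs_def])
  have "integral {0..B} (f F) * integral {0..B} (f G) \<le> 1"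
  proof (rule exponential_transport_bounded[where \<delta> = "1 / B * exp (- B)"])
    show "f F integrable_on {0..B}" "f G integrable_on {0..B}" by (fact f_int)+
    show "1 / B * exp (- B) \<le> f F x" "1 / B * exp (- B) \<le> f G x" if "x \<in> {0..B}" for x
      using that low[of F x] low[of G x] \<open>B \<ge> 1\<close> unfolding f_def by (intro mult_mono; simp)+
    fix x y
    have "enn2real (T F x * T G y) \<le> enn2real (ennreal (exp (smooth_abs (x - y) / 10)))"
      using TT by (intro enn2real_mono) auto
    then have "enn2real (T F x) * enn2real (T G y) \<le> exp (smooth_abs (x - y) / 10)"
      by (simp add: enn2real_mult)
    then have "enn2real (T F x) * enn2real (T G y) * exp (- x - y) \<le> exp (smooth_abs (x - y) / 10) * exp (- x - y)"
      by (intro mult_right_mono) auto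
    then show "f F x * f G y \<le> exp (smooth_abs (x - y) / 10 - x - y)"
      by (simp add: f_def algebra_simps exp_add[symmetric] exp_diff exp_minus divide_simps)
  qed (use \<open>B \<ge> 1\<close> in auto)
  then have "ennreal (integral {0..B} (f F)) * ennreal (integral {0..B} (f G)) \<le> 1"
    using f_int by (subst ennreal_mult'[symmetric])
      (auto simp: ennreal_le_1 f_def[abs_def] intro!: Henstock_Kurzweil_Integration.integral_nonneg)
  also have "ennreal (integral {0..B} (f F)) = (\<integral>\<^sup>+x. T F x * indicator {..B} x \<partial>exponential)"
    using nn_integral_exponential_truncated(2)[of "T F" B B] TB \<open>B \<ge> 1\<close> by (simp add: f_def[abs_def])
  also have "ennreal (integral {0..B} (f G)) = (\<integral>\<^sup>+x. T G x * indicator {..B} x \<partial>exponential)"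
    using nn_integral_exponential_truncated(2)[of "T G" B B] TB \<open>B \<ge> 1\<close> by (simp add: f_def[abs_def])
  finally have 1: "(\<integral>\<^sup>+x. T F x * indicator {..B} x \<partial>exponential) * (\<integral>\<^sup>+x. T G x * indicator {..B} x \<partial>exponential) \<le> 1" .
  have "(\<integral>\<^sup>+x. min (H x) (ennreal B) * indicator {..B} x \<partial>exponential) \<le> (\<integral>\<^sup>+x. T H x * indicator {..B} x \<partial>exponential)" for H
    by (intro nn_integral_mono mult_right_mono) (auto simp: T_def)
  then show ?thesis using 1 by (meson mult_mono order.trans zero_le)
qed

theorem transport_property_exponential:
  "transport_property exponential (\<lambda>x y. smooth_abs (x - y) / 10)"
proof (rule transport_propertyI)
  fix F G :: "real \<Rightarrow> ennreal"
  assume "F \<in> borel_measurable exponential" "G \<in> borel_measurable exponential"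
  then have [measurable]: "F \<in> borel_measurable borel" "G \<in> borel_measurable borel" by auto
  assume FG: "\<And>x y. x \<in> space exponential \<Longrightarrow> y \<in> space exponential \<Longrightarrow> F x * G y \<le> ennreal (exp (smooth_abs (x - y) / 10))"
  define A where "A H n = (\<integral>\<^sup>+x. min (H x) (ennreal (real n)) * indicator {..real n} x \<partial>exponential)"
    for H :: "real \<Rightarrow> ennreal" and n
  have mono: "A H i \<le> A H j" if "i \<le> j" for H i j
    unfolding A_def using that
    by (intro nn_integral_mono mult_mono) (auto simp: indicator_def min.coboundedI2 ennreal_leI min_le_iff_disj)
  have conv: "(\<integral>\<^sup>+x. H x \<partial>exponential) = (SUP n. A H n)" if [measurable]: "H \<in> borel_measurable borel" for H
  proof -
    have "H x = (SUP n. min (H x) (ennreal (real n)) * indicator {..real n} x)" for x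
    proof (rule antisym)
      show "(SUP n. min (H x) (ennreal (real n)) * indicator {..real n} x) \<le> H x"
        by (intro SUP_least) (auto simp: indicator_def)
      obtain k :: nat where k: "x \<le> real k" using real_arch_simple by blast
      show "H x \<le> (SUP n. min (H x) (ennreal (real n)) * indicator {..real n} x)"
      proof (rule le_SUP_iff[THEN iffD2, rule_format])
        fix y assume "y < H x"
        then obtain m :: nat where "y < of_nat m" using ennreal_Ex_less_of_nat by (metis order.strict_trans2 top_greatest)
        then have "y < ennreal (real (max k m))"
          by (metis ennreal_of_nat_eq_real_of_nat max.cobounded2 of_nat_le_iff order.strict_trans2 ennreal_leI)
        with \<open>y < H x\<close> k show "\<exists>n\<in>UNIV. y < min (H x) (ennreal (real n)) * indicator {..real n} x"
          by (intro bexI[of _ "max k m"]) (auto simp: indicator_def)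
      qed
    qed
    then have "(\<integral>\<^sup>+x. H x \<partial>exponential) = (\<integral>\<^sup>+x. (SUP n. min (H x) (ennreal (real n)) * indicator {..real n} x) \<partial>exponential)"
      by simp
    also have "\<dots> = (SUP n. A H n)"
      unfolding A_def
      by (rule nn_integral_monotone_convergence_SUP)
        (auto simp: incseq_def le_fun_def indicator_def min_le_iff_disj ennreal_leI intro!: mult_mono)
    finally show ?thesis .
  qed
  have "A F i * A G j \<le> 1" for i j
  proof -
    have "A F i * A G j \<le> A F (max 1 (max i j)) * A G (max 1 (max i j))"
      by (intro mult_mono mono) auto
    also have "\<dots> \<le> 1"
      unfolding A_def using FG by (intro exponential_transport_truncated) auto
    finally show ?thesis .
  qed
  then show "(\<integral>\<^sup>+x. F x \<partial>exponential) * (\<integral>\<^sup>+x. G x \<partial>exponential) \<le> 1"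
    by (subst (1 2) conv) (auto simp: SUP_mult_left_ennreal SUP_mult_right_ennreal intro!: SUP_least)
qed

section \<open>Tails of the measure with density exp (- |x| powr alpha)\<close>

abbreviation weight :: "real \<Rightarrow> real \<Rightarrow> real" where
  "weight \<alpha> x \<equiv> exp (- (\<bar>x\<bar> powr \<alpha>))"

text \<open>
  Chosen so that \<open>offset powr \<alpha> = 2 / \<alpha>\<close>; this makes \<open>y + offset\<close> large enough for the tail bound
  \<open>weight_tail_le\<close> to hold for all \<open>y > 0\<close>, and not only for large \<open>y\<close>.
\<close>

definition offset :: "real \<Rightarrow> real" where
  "offset \<alpha> = (2 / \<alpha>) powr (1 / \<alpha>)"

text \<open>
  An explicit substitute for the coordinate in which \<open>nu\<close> becomes the two-sided exponential law: it is
  odd, its modulus grows like \<open>\<bar>y\<bar> powr \<alpha> / 2\<close>, and, like the true coordinate and thanks to the offset, it has bounded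
  slope at the origin.
\<close>

definition profile :: "real \<Rightarrow> real \<Rightarrow> real" where
  "profile \<alpha> y = sgn y * ((offset \<alpha> + \<bar>y\<bar>) powr \<alpha> - 2 / \<alpha>) / 2"

lemma odd_increment_le:
  fixes f g :: "real \<Rightarrow> real"
  assumes odd: "\<And>x. f (- x) = - f x" "\<And>x. g (- x) = - g x"
    and le: "\<And>a b. 0 \<le> a \<Longrightarrow> a \<le> b \<Longrightarrow> f b - f a \<le> g b - g a"
    and "a \<le> b"
  shows "f b - f a \<le> g b - g a"
proof -
  have 0: "f 0 = 0" "g 0 = 0" using odd[of 0] by auto
  consider "0 \<le> a" | "b \<le> 0" | "a \<le> 0" "0 \<le> b" by linarith
  then show ?thesis
  proof cases
    case 1 then show ?thesis using le \<open>a \<le> b\<close> by blast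
  next
    case 2 then show ?thesis using le[of "- b" "- a"] odd \<open>a \<le> b\<close> by simp
  next
    case 3 then show ?thesis using le[of 0 b] le[of 0 "- a"] odd 0 by simp
  qed
qed

context
  fixes \<alpha> :: real
  assumes \<alpha>: "0 < \<alpha>" "\<alpha> < 1"
begin

lemma offset_pos: "0 < offset \<alpha>"
  using \<alpha> by (simp add: offset_def)

lemma offset_powr: "offset \<alpha> powr \<alpha> = 2 / \<alpha>"
  using \<alpha> by (simp add: offset_def powr_powr)

lemma profile_odd: "profile \<alpha> (- y) = - profile \<alpha> y"
  by (simp add: profile_def sgn_minus)

lemma profile_nonneg_eq: "0 \<le> y \<Longrightarrow> profile \<alpha> y = ((offset \<alpha> + y) powr \<alpha> - 2 / \<alpha>) / 2"
  by (cases "y = 0") (auto simp: profile_def offset_powr)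

lemma profile_strict_mono_nonneg: "0 \<le> a \<Longrightarrow> a < b \<Longrightarrow> profile \<alpha> a < profile \<alpha> b"
  using \<alpha> offset_pos by (simp add: profile_nonneg_eq powr_less_mono2)

text \<open>
  The right-hand side is minus an antiderivative whose derivative dominates the weight, so integrating
  to infinity gives the bound.  Relative to the weight, the offset makes the negative term of that derivative at most
  \<open>1 - \<alpha>\<close>, while the positive term is at least 2.
\<close>

lemma weight_tail_le:
  assumes "0 < y"
  shows "(\<integral>\<^sup>+x. ennreal (weight \<alpha> x) * indicator {y..} x \<partial>lborel)
          \<le> ennreal (2 / \<alpha> * (offset \<alpha> + y) powr (1 - \<alpha>) * exp (- (y powr \<alpha>)))"
proof -
  let ?b = "offset \<alpha>"
  define F where "F x = - (2 / \<alpha> * (?b + x) powr (1 - \<alpha>) * exp (- (x powr \<alpha>)))" for x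
  define f where "f x = (2 * (x powr (\<alpha> - 1) * (?b + x) powr (1 - \<alpha>))
      - 2 / \<alpha> * (1 - \<alpha>) * (?b + x) powr (- \<alpha>)) * exp (- (x powr \<alpha>))" for x
  have F: "(F has_real_derivative f x) (at x)" if "y \<le> x" for x
    unfolding F_def f_def using that \<alpha> assms offset_pos
    by (auto intro!: derivative_eq_intros simp: field_simps)
  have ge: "weight \<alpha> x \<le> f x" if "y \<le> x" for x
  proof -
    have "x powr (\<alpha> - 1) * (?b + x) powr (1 - \<alpha>) \<ge> x powr (\<alpha> - 1) * x powr (1 - \<alpha>)"
      using that assms \<alpha> offset_pos by (intro mult_left_mono powr_mono2) auto
    moreover have "x powr (\<alpha> - 1) * x powr (1 - \<alpha>) = 1" using that assms by (simp flip: powr_add)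
    moreover have "(?b + x) powr (- \<alpha>) \<le> ?b powr (- \<alpha>)"
      using that assms \<alpha> offset_pos by (intro powr_mono2') auto
    then have "2 / \<alpha> * (1 - \<alpha>) * (?b + x) powr (- \<alpha>) \<le> 2 / \<alpha> * (1 - \<alpha>) * (\<alpha> / 2)"
      using \<alpha> by (intro mult_left_mono) (auto simp: powr_minus offset_powr)
    moreover have "2 / \<alpha> * (1 - \<alpha>) * (\<alpha> / 2) = 1 - \<alpha>" using \<alpha> by simp
    ultimately have "1 \<le> 2 * (x powr (\<alpha> - 1) * (?b + x) powr (1 - \<alpha>))
      - 2 / \<alpha> * (1 - \<alpha>) * (?b + x) powr (- \<alpha>)" using \<alpha> by linarith
    from mult_right_mono[OF this, of "exp (- (x powr \<alpha>))"] show ?thesis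
      unfolding f_def using that assms by simp
  qed
  have lim: "(F \<longlongrightarrow> 0) at_top"
    unfolding F_def using \<alpha> offset_pos by real_asymp
  have [measurable]: "f \<in> borel_measurable borel" unfolding f_def by measurable
  have "(\<integral>\<^sup>+x. ennreal (weight \<alpha> x) * indicator {y..} x \<partial>lborel)
      \<le> (\<integral>\<^sup>+x. ennreal (f x) * indicator {y..} x \<partial>lborel)"
    using ge by (intro nn_integral_mono) (auto simp: indicator_def ennreal_leI)
  also have "\<dots> = ennreal (0 - F y)"
    using F ge lim by (intro nn_integral_FTC_atLeast) (auto intro: order.trans[OF exp_ge_zero])
  finally show ?thesis by (simp add: F_def)
qed

lemma weight_integrable: "integrable lborel (weight \<alpha>)"
proof -
  have reflect: "(\<integral>\<^sup>+x. ennreal (weight \<alpha> x) * indicator {..-1} x \<partial>lborel)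
      = (\<integral>\<^sup>+x. ennreal (weight \<alpha> x) * indicator {1..} x \<partial>lborel)"
    by (subst nn_integral_real_affine[of _ "-1" 0]) (auto intro!: nn_integral_cong simp: indicator_def)
  have fin: "(\<integral>\<^sup>+x. ennreal (weight \<alpha> x) * indicator {1..} x \<partial>lborel) < \<top>"
    using weight_tail_le[of 1] by (simp add: order.strict_trans1)
  have "(\<integral>\<^sup>+x. ennreal (weight \<alpha> x) \<partial>lborel) \<le>
     (\<integral>\<^sup>+x. ennreal (weight \<alpha> x) * indicator {..-1} x + indicator {-1..1} x
        + ennreal (weight \<alpha> x) * indicator {1..} x \<partial>lborel)"
    by (intro nn_integral_mono) (auto simp: indicator_def)
  also have "\<dots> = (\<integral>\<^sup>+x. ennreal (weight \<alpha> x) * indicator {..-1} x \<partial>lborel) + 2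
     + (\<integral>\<^sup>+x. ennreal (weight \<alpha> x) * indicator {1..} x \<partial>lborel)"
    by (simp add: nn_integral_add)
  also have "\<dots> < \<top>" using fin reflect by simp
  finally show ?thesis by (intro integrableI_bounded) auto
qed

lemma norm_const_pos: "0 < norm_const \<alpha>"
proof -
  have "integral\<^sup>L lborel (\<lambda>x::real. indicator {0..1} x * exp (-1)) \<le> integral\<^sup>L lborel (weight \<alpha>)"
  proof (rule integral_mono)
    show "integrable lborel (weight \<alpha>)" by (rule weight_integrable)
    show "indicator {0..1} x * exp (-1) \<le> weight \<alpha> x" for x
      using \<alpha> by (auto simp: indicator_def powr_le1)
  qed simp
  then have "exp (-1) \<le> norm_const \<alpha>" by (simp add: norm_const_def)
  then show ?thesis by (simp add: less_le_trans[of 0 "exp (-1)"])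
qed

lemma sets_nu [simp, measurable_cong]: "sets (nu \<alpha>) = sets borel"
  by (simp add: nu_def)

lemma space_nu [simp]: "space (nu \<alpha>) = UNIV"
  by (simp add: nu_def)

lemma real_distribution_nu: "real_distribution (nu \<alpha>)"
proof -
  have "emeasure (nu \<alpha>) (space (nu \<alpha>)) = (\<integral>\<^sup>+x. ennreal (weight \<alpha> x / norm_const \<alpha>) \<partial>lborel)"
    by (simp add: nu_def emeasure_density)
  also have "\<dots> = ennreal (\<integral>x. weight \<alpha> x / norm_const \<alpha> \<partial>lborel)"
    using weight_integrable norm_const_pos by (intro nn_integral_eq_integral) (auto simp: less_imp_le)
  also have "(\<integral>x. weight \<alpha> x / norm_const \<alpha> \<partial>lborel) = 1"
    using norm_const_pos by (simp add: norm_const_def[symmetric])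
  finally have "prob_space (nu \<alpha>)" by (intro prob_spaceI) simp
  then show ?thesis by (intro real_distribution.intro real_distribution_axioms.intro) auto
qed

interpretation nu: real_distribution "nu \<alpha>" by (rule real_distribution_nu)

lemma emeasure_nu: "A \<in> sets borel \<Longrightarrow>
    emeasure (nu \<alpha>) A = (\<integral>\<^sup>+x. ennreal (weight \<alpha> x / norm_const \<alpha>) * indicator A x \<partial>lborel)"
  by (simp add: nu_def emeasure_density)

lemma measure_nu_singleton: "measure (nu \<alpha>) {y} = 0"
  by (simp add: measure_def emeasure_nu)

lemma measure_nu_reflect: "measure (nu \<alpha>) {..- y} = measure (nu \<alpha>) {y..}"
proof -
  have "emeasure (nu \<alpha>) {..- y} = emeasure (nu \<alpha>) {y..}"
    unfolding emeasure_nu[OF borel_closed[OF closed_atMost]] emeasure_nu[OF borel_closed[OF closed_atLeast]]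
    by (subst nn_integral_real_affine[of _ "-1" 0]) (auto intro!: nn_integral_cong simp: indicator_def)
  then show ?thesis by (simp add: measure_def)
qed

lemma measure_nu_Icc: "measure (nu \<alpha>) {a..b} = integral {a..b} (\<lambda>x. weight \<alpha> x / norm_const \<alpha>)"
proof -
  let ?w = "\<lambda>x. weight \<alpha> x / norm_const \<alpha>"
  have int: "set_integrable lborel {a..b} ?w"
    unfolding set_integrable_def using weight_integrable
    by (intro integrable_mult_indicator) auto
  have "emeasure (nu \<alpha>) {a..b} = (\<integral>\<^sup>+x. ennreal (indicator {a..b} x *\<^sub>R ?w x) \<partial>lborel)"
    by (subst emeasure_nu) (auto intro!: nn_integral_cong simp: indicator_def)
  also have "\<dots> = ennreal (\<integral>x. indicator {a..b} x *\<^sub>R ?w x \<partial>lborel)"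
    using int norm_const_pos unfolding set_integrable_def
    by (intro nn_integral_eq_integral) (auto simp: less_imp_le)
  also have "(\<integral>x. indicator {a..b} x *\<^sub>R ?w x \<partial>lborel) = integral {a..b} ?w"
    using set_borel_integral_eq_integral(2)[OF int] by (simp add: set_lebesgue_integral_def)
  finally have "emeasure (nu \<alpha>) {a..b} = ennreal (integral {a..b} ?w)" .
  moreover have "0 \<le> integral {a..b} ?w"
    using norm_const_pos
    by (intro Henstock_Kurzweil_Integration.integral_nonneg set_borel_integral_eq_integral(1)[OF int])
      (auto simp: less_imp_le)
  ultimately show ?thesis by (simp only: measure_def enn2real_ennreal)
qed

lemma measure_nu_atLeast_split:
  assumes "a \<le> b"
  shows "measure (nu \<alpha>) {a..} = measure (nu \<alpha>) {a..b} + measure (nu \<alpha>) {b..}"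
proof -
  have "{a..} = {a..b} \<union> {b..}" "{a..b} \<inter> {b..} = {b}" using assms by auto
  then show ?thesis
    using nu.finite_measure_Union'[of "{a..b}" "{b..}"] nu.finite_measure_Diff'[of "{b..}" "{a..b}"] measure_nu_singleton[of b]
    by (simp add: Int_commute)
qed

lemma measure_nu_half: "measure (nu \<alpha>) {0..} = 1 / 2"
proof -
  have "{..0} \<union> {0..} = (UNIV :: real set)" "{..0} \<inter> {0..} = {0 :: real}" by auto
  then have "1 = measure (nu \<alpha>) {..0} + measure (nu \<alpha>) {0..}"
    using nu.finite_measure_Union'[of "{..0}" "{0..}"] nu.finite_measure_Diff'[of "{0..}" "{..0}"] measure_nu_singleton[of 0] nu.prob_space
    by (simp add: Int_commute)
  then show ?thesis using measure_nu_reflect[of 0] by simp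
qed

lemma weight_continuous: "continuous_on S (\<lambda>x. weight \<alpha> x / norm_const \<alpha>)"
  using \<alpha> norm_const_pos by (intro continuous_intros continuous_on_powr') auto

lemma measure_nu_atLeast_pos: "0 < measure (nu \<alpha>) {y..}"
proof -
  have "0 < measure (nu \<alpha>) {y..y+1}"
  proof -
    define m where "m = exp (- ((\<bar>y\<bar> + 1) powr \<alpha>)) / norm_const \<alpha>"
    have "integral {y..y+1} (\<lambda>_. m) \<le> integral {y..y+1} (\<lambda>x. weight \<alpha> x / norm_const \<alpha>)"
      using \<alpha> norm_const_pos unfolding m_def
      by (intro integral_le integrable_continuous_real weight_continuous) (auto intro!: divide_right_mono powr_mono2)
    moreover have "0 < m" using norm_const_pos by (simp add: m_def)
    ultimately show ?thesis by (simp add: measure_nu_Icc)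
  qed
  also have "\<dots> \<le> measure (nu \<alpha>) {y..}" by (intro nu.finite_measure_mono) auto
  finally show ?thesis .
qed

lemma measure_nu_atLeast_le:
  assumes "0 < y"
  shows "measure (nu \<alpha>) {y..} * norm_const \<alpha> \<le> 2 / \<alpha> * (offset \<alpha> + y) powr (1 - \<alpha>) * exp (- (y powr \<alpha>))"
    (is "_ \<le> ?R")
proof -
  have "emeasure (nu \<alpha>) {y..} = (\<integral>\<^sup>+x. ennreal (1 / norm_const \<alpha>) * (ennreal (weight \<alpha> x) * indicator {y..} x) \<partial>lborel)"
    using norm_const_pos by (subst emeasure_nu) (auto intro!: nn_integral_cong simp: indicator_def simp flip: ennreal_mult)
  also have "\<dots> = ennreal (1 / norm_const \<alpha>) * (\<integral>\<^sup>+x. ennreal (weight \<alpha> x) * indicator {y..} x \<partial>lborel)"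
    by (rule nn_integral_cmult) measurable
  also have "\<dots> \<le> ennreal (1 / norm_const \<alpha>) * ennreal ?R"
    by (intro mult_left_mono weight_tail_le assms) auto
  also have "\<dots> = ennreal (?R / norm_const \<alpha>)"
    using norm_const_pos \<alpha> by (simp flip: ennreal_mult)
  finally have "measure (nu \<alpha>) {y..} \<le> ?R / norm_const \<alpha>"
    using norm_const_pos \<alpha> by (simp add: nu.emeasure_eq_measure)
  then show ?thesis using norm_const_pos by (simp only: pos_le_divide_eq)
qed

lemma measure_nu_atLeast_eq:
  "0 \<le> y \<Longrightarrow> measure (nu \<alpha>) {y..} = 1 / 2 - integral {0..y} (\<lambda>x. weight \<alpha> x / norm_const \<alpha>)"
  using measure_nu_atLeast_split[of 0 y] by (simp add: measure_nu_half measure_nu_Icc)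

lemma measure_nu_atLeast_continuous: "continuous_on {0..b} (\<lambda>y. measure (nu \<alpha>) {y..})"
proof -
  have "continuous_on {0..b} (\<lambda>y. 1 / 2 - integral {0..y} (\<lambda>x. weight \<alpha> x / norm_const \<alpha>))"
    by (intro continuous_intros indefinite_integral_continuous_1 integrable_continuous_real weight_continuous)
  then show ?thesis
    by (rule continuous_on_eq) (simp add: measure_nu_atLeast_eq)
qed

lemma measure_nu_atLeast_DERIV:
  assumes "0 < y"
  shows "((\<lambda>y. measure (nu \<alpha>) {y..}) has_real_derivative - (weight \<alpha> y / norm_const \<alpha>)) (at y)"
proof -
  have "((\<lambda>y. integral {0..y} (\<lambda>x. weight \<alpha> x / norm_const \<alpha>)) has_real_derivative weight \<alpha> y / norm_const \<alpha>)
      (at y within {0..y+1})"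
    using assms by (intro integral_has_real_derivative weight_continuous) auto
  then have "((\<lambda>y. integral {0..y} (\<lambda>x. weight \<alpha> x / norm_const \<alpha>)) has_real_derivative weight \<alpha> y / norm_const \<alpha>) (at y)"
    using assms by (simp add: at_within_Icc_at)
  then have "((\<lambda>y. 1 / 2 - integral {0..y} (\<lambda>x. weight \<alpha> x / norm_const \<alpha>)) has_real_derivative - (weight \<alpha> y / norm_const \<alpha>)) (at y)"
    by (rule DERIV_diff[OF DERIV_const, THEN DERIV_cong]) simp
  then show ?thesis
    by (rule DERIV_cong_ev[THEN iffD1, rotated -1])
      (use assms in \<open>auto simp: measure_nu_atLeast_eq eventually_nhds intro!: exI[of _ "{0<..}"]\<close>)
qed

text \<open>
  The tail bound says that the hazard rate (density over tail) of \<open>nu\<close> at \<open>y\<close> is at least the derivative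
  \<open>\<alpha>/2 * (offset + y) powr (\<alpha> - 1)\<close> of the profile; hence tail times \<open>exp profile\<close> decreases.
\<close>

lemma measure_nu_atLeast_decay:
  assumes "0 \<le> a" "a \<le> b"
  shows "measure (nu \<alpha>) {b..} * exp (profile \<alpha> b) \<le> measure (nu \<alpha>) {a..} * exp (profile \<alpha> a)"
proof -
  let ?q = "\<lambda>y. measure (nu \<alpha>) {y..}" and ?b = "offset \<alpha>"
  let ?p = "\<lambda>y. ((?b + y) powr \<alpha> - 2 / \<alpha>) / 2"
  have "?q b * exp (?p b) \<le> ?q a * exp (?p a)"
  proof (rule DERIV_nonpos_imp_decreasing_open[OF assms(2)])
    show "continuous_on {a..b} (\<lambda>y. ?q y * exp (?p y))"
      using assms offset_pos \<alpha>
      by (intro continuous_intros continuous_on_subset[OF measure_nu_atLeast_continuous[of b]]) auto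
    fix y assume y: "a < y" "y < b"
    then have "0 < y" using assms by simp
    let ?d = "exp (?p y) * (?q y * (\<alpha> / 2 * (?b + y) powr (\<alpha> - 1)) - weight \<alpha> y / norm_const \<alpha>)"
    have "((\<lambda>y. ?q y * exp (?p y)) has_real_derivative ?d) (at y)"
      using \<open>0 < y\<close> offset_pos
      by (auto intro!: derivative_eq_intros measure_nu_atLeast_DERIV simp: algebra_simps)
    moreover have "?d \<le> 0"
    proof -
      have "?q y * norm_const \<alpha> * (\<alpha> / 2 * (?b + y) powr (\<alpha> - 1))
          \<le> (2 / \<alpha> * (?b + y) powr (1 - \<alpha>) * exp (- (y powr \<alpha>))) * (\<alpha> / 2 * (?b + y) powr (\<alpha> - 1))"
        using \<alpha> \<open>0 < y\<close> by (intro mult_right_mono measure_nu_atLeast_le) auto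
      also have "\<dots> = weight \<alpha> y * ((?b + y) powr (1 - \<alpha>) * (?b + y) powr (\<alpha> - 1))"
        using \<alpha> \<open>0 < y\<close> by (simp add: field_simps)
      also have "(?b + y) powr (1 - \<alpha>) * (?b + y) powr (\<alpha> - 1) = 1"
        using offset_pos \<open>0 < y\<close> by (simp flip: powr_add)
      finally have "?q y * (\<alpha> / 2 * (?b + y) powr (\<alpha> - 1)) \<le> weight \<alpha> y / norm_const \<alpha>"
        using norm_const_pos by (simp add: field_simps)
      then show ?thesis by (simp add: mult_le_0_iff)
    qed
    ultimately show "\<exists>z. ((\<lambda>y. ?q y * exp (?p y)) has_real_derivative z) (at y) \<and> z \<le> 0" by blast
  qed
  then show ?thesis using assms by (simp add: profile_nonneg_eq)
qed

end

section \<open>The measure as an image of two exponential variables\<close>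

text \<open>
  The increasing rearrangement of \<open>nu\<close> onto the two-sided exponential law: for \<open>y \<ge> 0\<close> the tail of \<open>nu\<close>
  at \<open>y\<close> equals \<open>exp (- score) / 2\<close>.
\<close>

definition laplace_score :: "real \<Rightarrow> real \<Rightarrow> real" where
  "laplace_score \<alpha> y = sgn y * (- ln (2 * measure (nu \<alpha>) {\<bar>y\<bar>..}))"

lemma nn_integral_exp_atLeast:
  "0 < l \<Longrightarrow> (\<integral>\<^sup>+x. ennreal (exp (- l * x)) * indicator {t..} x \<partial>lborel) = ennreal (exp (- l * t) / l)"
proof -
  assume l: "0 < l"
  have lim: "((\<lambda>x. - exp (- l * x) / l) \<longlongrightarrow> 0) at_top" using l by real_asymp
  have "(\<integral>\<^sup>+x. ennreal (exp (- l * x)) * indicator {t..} x \<partial>lborel) = ennreal (0 - (- exp (- l * t) / l))"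
    using l by (intro nn_integral_FTC_atLeast[OF _ _ _ lim]) (auto intro!: derivative_eq_intros)
  then show ?thesis by simp
qed

lemma prob_space_exponential: "prob_space exponential"
  by (rule prob_space_exponential_density) simp

lemma emeasure_exponential_atLeast:
  assumes "0 \<le> t"
  shows "emeasure exponential {t..} = ennreal (exp (- t))"
proof -
  have "emeasure exponential {t..} = (\<integral>\<^sup>+x. ennreal (exp (- 1 * x)) * indicator {t..} x \<partial>lborel)"
    using assms by (subst emeasure_density) (auto intro!: nn_integral_cong simp: exponential_density_def indicator_def)
  then show ?thesis using nn_integral_exp_atLeast[of 1 t] by simp
qed

lemma emeasure_exponential_greaterThan:
  assumes "0 \<le> t"
  shows "emeasure exponential {t<..} = ennreal (exp (- t))"
proof -
  have "emeasure exponential {t<..} = emeasure exponential {t..}"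
    using AE_lborel_singleton[of t]
    by (subst (1 2) emeasure_density) (auto intro!: nn_integral_cong_AE elim!: eventually_mono simp: indicator_def)
  then show ?thesis using emeasure_exponential_atLeast[OF assms] by simp
qed

abbreviation exponential_pair :: "(real \<times> real) measure" where
  "exponential_pair \<equiv> exponential \<Otimes>\<^sub>M exponential"

lemma prob_space_exponential_pair: "prob_space exponential_pair"
  by (intro prob_space_pair prob_space_exponential)

lemma nn_integral_exponential_shift:
  assumes "0 \<le> t" "\<And>x. 0 \<le> x \<Longrightarrow> F x = ennreal (exp (- (x + t)))"
  shows "(\<integral>\<^sup>+x. F x \<partial>exponential) = ennreal (exp (- t) / 2)"
proof -
  have "(\<integral>\<^sup>+x. F x \<partial>exponential) = (\<integral>\<^sup>+x. ennreal (exp (- (x + t))) \<partial>exponential)"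
    using assms(2) by (intro nn_integral_cong_AE) (auto simp: AE_density exponential_density_def)
  also have "\<dots> = (\<integral>\<^sup>+x. ennreal (exponential_density 1 x) * ennreal (exp (- (x + t))) \<partial>lborel)"
    by (rule nn_integral_density) measurable
  also have "\<dots> = (\<integral>\<^sup>+x. ennreal (exp (- t)) * (ennreal (exp (- 2 * x)) * indicator {0..} x) \<partial>lborel)"
    using assms by (intro nn_integral_cong)
      (auto simp: exponential_density_def indicator_def simp flip: ennreal_mult exp_add)
  also have "\<dots> = ennreal (exp (- t)) * ennreal (1 / 2)"
    using nn_integral_exp_atLeast[of 2 0] by (simp add: nn_integral_cmult)
  also have "\<dots> = ennreal (exp (- t) / 2)" by (simp only: ennreal_mult[symmetric] exp_ge_zero) simp
  finally show ?thesis .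
qed

lemma difference_le_borel: "{w. fst w - snd w \<le> z} \<in> sets (borel \<Otimes>\<^sub>M borel :: (real \<times> real) measure)"
proof -
  have "{w \<in> space (borel \<Otimes>\<^sub>M borel). fst w - snd w \<le> z} \<in> sets (borel \<Otimes>\<^sub>M borel :: (real \<times> real) measure)"
    by measurable
  then show ?thesis by (simp add: space_pair_measure)
qed

lemma difference_gt_borel: "{w. z < fst w - snd w} \<in> sets (borel \<Otimes>\<^sub>M borel :: (real \<times> real) measure)"
proof -
  have "{w \<in> space (borel \<Otimes>\<^sub>M borel). z < fst w - snd w} \<in> sets (borel \<Otimes>\<^sub>M borel :: (real \<times> real) measure)"
    by measurable
  then show ?thesis by (simp add: space_pair_measure)
qed

lemma measure_exponential_difference_le:
  assumes "z \<le> 0"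
  shows "measure exponential_pair {w. fst w - snd w \<le> z} = exp z / 2"
proof -
  interpret E: prob_space exponential by (rule prob_space_exponential)
  have [measurable]: "{w. fst w - snd w \<le> z} \<in> sets (borel \<Otimes>\<^sub>M borel)"
    by (rule difference_le_borel)
  have "emeasure exponential_pair {w. fst w - snd w \<le> z} =
      (\<integral>\<^sup>+x. emeasure exponential (Pair x -` {w. fst w - snd w \<le> z}) \<partial>exponential)"
    by (rule E.emeasure_pair_measure_alt) measurable
  also have "\<dots> = (\<integral>\<^sup>+x. emeasure exponential {x - z..} \<partial>exponential)"
    by (intro nn_integral_cong arg_cong2[where f = emeasure]) auto
  also have "\<dots> = ennreal (exp (- (- z)) / 2)"
    using assms by (intro nn_integral_exponential_shift) (auto simp: emeasure_exponential_atLeast)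
  finally show ?thesis by (simp add: measure_def)
qed

lemma measure_exponential_difference_gt:
  assumes "0 \<le> z"
  shows "measure exponential_pair {w. z < fst w - snd w} = exp (- z) / 2"
proof -
  interpret E: prob_space exponential by (rule prob_space_exponential)
  interpret E2: pair_sigma_finite exponential exponential ..
  have [measurable]: "{w. z < fst w - snd w} \<in> sets (borel \<Otimes>\<^sub>M borel)"
    by (rule difference_gt_borel)
  have "emeasure exponential_pair {w. z < fst w - snd w} =
      (\<integral>\<^sup>+y. emeasure exponential ((\<lambda>x. (x, y)) -` {w. z < fst w - snd w}) \<partial>exponential)"
    by (rule E2.emeasure_pair_measure_alt2) measurable
  also have "\<dots> = (\<integral>\<^sup>+y. emeasure exponential {y + z<..} \<partial>exponential)"
    by (intro nn_integral_cong arg_cong2[where f = emeasure]) auto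
  also have "\<dots> = ennreal (exp (- z) / 2)"
    using assms by (intro nn_integral_exponential_shift) (auto simp: emeasure_exponential_greaterThan)
  finally show ?thesis by (simp add: measure_def)
qed

text \<open>
  The infimum convolution of the exponential cost with itself, that is, the least of
  \<open>smooth_abs u / 10 + smooth_abs u' / 10\<close> over \<open>u + u' = v\<close>; by convexity it is attained at \<open>u = u' = v/2\<close>.
\<close>

definition two_sided_cost :: "real \<Rightarrow> real" where
  "two_sided_cost v = smooth_abs (v / 2) / 5"

lemma two_sided_cost_mono: "\<bar>u\<bar> \<le> \<bar>v\<bar> \<Longrightarrow> two_sided_cost u \<le> two_sided_cost v"
  using power_mono[of "\<bar>u\<bar>" "\<bar>v\<bar>" 2] by (simp add: two_sided_cost_def smooth_abs_def power_divide)

lemma two_sided_cost_diff_le: "two_sided_cost (u - v) \<le> smooth_abs u / 10 + smooth_abs v / 10"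
proof -
  have "sqrt ((1 + 1)\<^sup>2 + (u + (- v))\<^sup>2) \<le> sqrt (1\<^sup>2 + u\<^sup>2) + sqrt (1\<^sup>2 + (- v)\<^sup>2)"
    by (rule real_sqrt_sum_squares_triangle_ineq)
  moreover have "sqrt ((1 + 1)\<^sup>2 + (u + (- v))\<^sup>2) = 2 * sqrt (1 + ((u - v) / 2)\<^sup>2)"
    by (rule real_sqrt_unique) (auto simp: power_mult_distrib power_divide real_sqrt_pow2 add_nonneg_nonneg)
  ultimately have "2 * smooth_abs ((u - v) / 2) \<le> smooth_abs u + smooth_abs v"
    by (simp add: smooth_abs_def)
  then show ?thesis by (simp add: two_sided_cost_def)
qed

context
  fixes \<alpha> :: real
  assumes \<alpha>: "0 < \<alpha>" "\<alpha> < 1"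
begin

interpretation nu: real_distribution "nu \<alpha>" by (rule real_distribution_nu[OF \<alpha>])

lemma laplace_score_odd: "laplace_score \<alpha> (- y) = - laplace_score \<alpha> y"
  by (simp add: laplace_score_def sgn_minus)

lemma laplace_score_nonneg_eq: "0 \<le> y \<Longrightarrow> laplace_score \<alpha> y = - ln (2 * measure (nu \<alpha>) {y..})"
  by (cases "y = 0") (auto simp: laplace_score_def measure_nu_half[OF \<alpha>])

lemma measure_nu_atLeast_score: "0 \<le> y \<Longrightarrow> measure (nu \<alpha>) {y..} = exp (- laplace_score \<alpha> y) / 2"
  using measure_nu_atLeast_pos[OF \<alpha>, of y] by (simp add: laplace_score_nonneg_eq)

text \<open>
  On the positive axis this is the decay of tail times \<open>exp profile\<close>, and oddness gives the rest.  So passing from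
  the two-sided exponential coordinate to the profile is a contraction, and costs do not increase.
\<close>

lemma profile_increment_le_score:
  "a \<le> b \<Longrightarrow> profile \<alpha> b - profile \<alpha> a \<le> laplace_score \<alpha> b - laplace_score \<alpha> a"
proof (rule odd_increment_le[where f = "profile \<alpha>" and g = "laplace_score \<alpha>"])
  show "profile \<alpha> (- x) = - profile \<alpha> x" "laplace_score \<alpha> (- x) = - laplace_score \<alpha> x" for x
    by (rule profile_odd[OF \<alpha>] laplace_score_odd)+
  fix a b :: real assume ab: "0 \<le> a" "a \<le> b"
  have "exp (- laplace_score \<alpha> b) / 2 * exp (profile \<alpha> b) \<le> exp (- laplace_score \<alpha> a) / 2 * exp (profile \<alpha> a)"
    using measure_nu_atLeast_decay[OF \<alpha> ab] ab by (simp add: measure_nu_atLeast_score)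
  then have "exp (profile \<alpha> b - laplace_score \<alpha> b) \<le> exp (profile \<alpha> a - laplace_score \<alpha> a)"
    by (simp add: exp_diff exp_minus divide_simps mult.commute)
  then show "profile \<alpha> b - profile \<alpha> a \<le> laplace_score \<alpha> b - laplace_score \<alpha> a" by simp
qed

lemma profile_strict_mono: "a < b \<Longrightarrow> profile \<alpha> a < profile \<alpha> b"
proof -
  assume "a < b"
  consider "0 \<le> a" | "b \<le> 0" | "a < 0" "0 < b" using \<open>a < b\<close> by linarith
  then show ?thesis
  proof cases
    case 1 then show ?thesis using profile_strict_mono_nonneg[OF \<alpha>] \<open>a < b\<close> by blast
  next
    case 2 then show ?thesis
      using profile_strict_mono_nonneg[OF \<alpha>, of "- b" "- a"] \<open>a < b\<close> by (simp add: profile_odd[OF \<alpha>])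
  next
    case 3
    then show ?thesis
      using profile_strict_mono_nonneg[OF \<alpha>, of 0 b] profile_strict_mono_nonneg[OF \<alpha>, of 0 "- a"]
      by (simp add: profile_odd[OF \<alpha>] profile_def)
  qed
qed

lemma laplace_score_strict_mono: "strict_mono (laplace_score \<alpha>)"
proof (rule strict_monoI)
  fix a b :: real assume "a < b"
  then show "laplace_score \<alpha> a < laplace_score \<alpha> b"
    using profile_increment_le_score[of a b] profile_strict_mono[of a b] by simp
qed

lemma laplace_score_surj: "surj (laplace_score \<alpha>)"
proof -
  have pos: "\<exists>y\<ge>0. laplace_score \<alpha> y = z" if "0 \<le> z" for z
  proof -
    have "filterlim (\<lambda>y. ((offset \<alpha> + y) powr \<alpha> - 2 / \<alpha>) / 2) at_top at_top"
      using \<alpha> offset_pos[OF \<alpha>] by real_asymp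
    then have "eventually (\<lambda>y. z \<le> ((offset \<alpha> + y) powr \<alpha> - 2 / \<alpha>) / 2 \<and> 0 \<le> y) at_top"
      by (auto simp: filterlim_at_top intro: eventually_conj eventually_ge_at_top)
    then obtain b where b: "z \<le> ((offset \<alpha> + b) powr \<alpha> - 2 / \<alpha>) / 2" "0 \<le> b"
      using eventually_happens'[OF trivial_limit_at_top_linorder] by blast
    have 0: "laplace_score \<alpha> 0 = 0" "profile \<alpha> 0 = 0" by (auto simp: laplace_score_def profile_def)
    have "z \<le> laplace_score \<alpha> b"
      using b profile_increment_le_score[of 0 b] by (simp add: 0 profile_nonneg_eq[OF \<alpha>])
    moreover have "continuous_on {0..b} (laplace_score \<alpha>)"
    proof -
      have "continuous_on {0..b} (\<lambda>y. - ln (2 * measure (nu \<alpha>) {y..}))"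
        using less_imp_neq[OF measure_nu_atLeast_pos[OF \<alpha>]]
        by (intro continuous_intros measure_nu_atLeast_continuous[OF \<alpha>]) (metis mult_eq_0_iff zero_neq_numeral)
      then show ?thesis by (rule continuous_on_eq) (simp add: laplace_score_nonneg_eq)
    qed
    ultimately show ?thesis using IVT'[of "laplace_score \<alpha>" 0 z b] b 0 that by auto
  qed
  have "\<exists>y. laplace_score \<alpha> y = z" for z
    using pos[of z] pos[of "- z"] laplace_score_odd by (cases "0 \<le> z") (auto, metis minus_minus)
  then show ?thesis by (metis surjI)
qed

lemma cdf_nu_eq:
  "measure (nu \<alpha>) {..y} = measure exponential_pair {w. fst w - snd w \<le> laplace_score \<alpha> y}"
proof (cases "0 \<le> y")
  case False
  then have "measure (nu \<alpha>) {..y} = exp (laplace_score \<alpha> y) / 2"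
    using measure_nu_reflect[OF \<alpha>, of "- y"] measure_nu_atLeast_score[of "- y"] laplace_score_odd[of y] by simp
  moreover have "laplace_score \<alpha> y \<le> 0"
    using strict_monoD[OF laplace_score_strict_mono, of y 0] False by (simp add: laplace_score_def)
  ultimately show ?thesis by (simp add: measure_exponential_difference_le)
next
  case True
  interpret P: prob_space exponential_pair by (rule prob_space_exponential_pair)
  have s: "0 \<le> laplace_score \<alpha> y"
    using strict_mono_mono[OF laplace_score_strict_mono, THEN monoD, of 0 y] True by (simp add: laplace_score_def)
  have "{..y} = UNIV - {y..} \<union> {y}" by auto
  then have "measure (nu \<alpha>) {..y} = measure (nu \<alpha>) (UNIV - {y..}) + measure (nu \<alpha>) {y}"
    using nu.finite_measure_Union[of "UNIV - {y..}" "{y}"] by simp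
  also have "\<dots> = 1 - exp (- laplace_score \<alpha> y) / 2"
    using nu.prob_compl[of "{y..}"] True by (simp add: measure_nu_singleton[OF \<alpha>] measure_nu_atLeast_score)
  also have "\<dots> = 1 - P.prob {w. laplace_score \<alpha> y < fst w - snd w}"
    using s by (simp add: measure_exponential_difference_gt)
  also have "\<dots> = P.prob (space exponential_pair - {w. laplace_score \<alpha> y < fst w - snd w})"
    using difference_gt_borel by (subst P.prob_compl) (auto cong: sets_pair_measure_cong)
  also have "space exponential_pair - {w. laplace_score \<alpha> y < fst w - snd w} = {w. fst w - snd w \<le> laplace_score \<alpha> y}"
    by (auto simp: space_pair_measure)
  finally show ?thesis .
qed

lemma inv_laplace_score_le_iff: "inv (laplace_score \<alpha>) z \<le> y \<longleftrightarrow> z \<le> laplace_score \<alpha> y"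
  using strict_mono_less_eq[OF laplace_score_strict_mono, of "inv (laplace_score \<alpha>) z" y]
  by (simp add: surj_f_inv_f[OF laplace_score_surj])

lemma inv_laplace_score_measurable [measurable]: "inv (laplace_score \<alpha>) \<in> borel_measurable borel"
proof (rule borel_measurable_mono)
  show "mono (inv (laplace_score \<alpha>))"
    by (rule monoI) (auto simp: inv_laplace_score_le_iff surj_f_inv_f[OF laplace_score_surj])
qed

text \<open>
  A difference of two independent exponential variables has the two-sided exponential law, and the
  inverse of the score carries that law to \<open>nu\<close>.  Writing the two-sided law as an image of two one-sided
  ones reduces its transport property to the half-line.
\<close>

lemma nu_eq_distr:
  "nu \<alpha> = distr exponential_pair borel (\<lambda>w. inv (laplace_score \<alpha>) (fst w - snd w))"
proof (rule cdf_unique)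
  interpret P: prob_space exponential_pair by (rule prob_space_exponential_pair)
  show "real_distribution (nu \<alpha>)" ..
  show "real_distribution (distr exponential_pair borel (\<lambda>w. inv (laplace_score \<alpha>) (fst w - snd w)))"
    by (rule P.real_distribution_distr) measurable
  show "cdf (nu \<alpha>) = cdf (distr exponential_pair borel (\<lambda>w. inv (laplace_score \<alpha>) (fst w - snd w)))"
  proof
    fix y
    have "(\<lambda>w. inv (laplace_score \<alpha>) (fst w - snd w)) -` {..y} \<inter> space exponential_pair
        = {w. fst w - snd w \<le> laplace_score \<alpha> y}"
      by (auto simp: space_pair_measure inv_laplace_score_le_iff)
    then show "cdf (nu \<alpha>) y = cdf (distr exponential_pair borel (\<lambda>w. inv (laplace_score \<alpha>) (fst w - snd w))) y"
      unfolding cdf_def cdf_nu_eq by (subst measure_distr) auto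
  qed
qed

theorem transport_property_nu:
  "transport_property (nu \<alpha>) (\<lambda>x y. two_sided_cost (profile \<alpha> x - profile \<alpha> y))"
proof -
  interpret E: prob_space exponential by (rule prob_space_exponential)
  have "transport_property exponential_pair (\<lambda>x y. smooth_abs (fst x - fst y) / 10 + smooth_abs (snd x - snd y) / 10)"
    by (intro transport_property_pair transport_property_exponential) unfold_locales
  then show ?thesis
    unfolding nu_eq_distr
  proof (rule transport_property_image)
    fix v w :: "real \<times> real"
    let ?x = "inv (laplace_score \<alpha>) (fst v - snd v)" and ?y = "inv (laplace_score \<alpha>) (fst w - snd w)"
    have "\<bar>profile \<alpha> ?x - profile \<alpha> ?y\<bar> \<le> \<bar>laplace_score \<alpha> ?x - laplace_score \<alpha> ?y\<bar>"
      using profile_increment_le_score[of ?x ?y] profile_increment_le_score[of ?y ?x]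
        profile_strict_mono[of ?x ?y] profile_strict_mono[of ?y ?x]
      by (cases ?x ?y rule: linorder_cases) auto
    also have "laplace_score \<alpha> ?x - laplace_score \<alpha> ?y = (fst v - fst w) - (snd v - snd w)"
      by (simp add: surj_f_inv_f[OF laplace_score_surj])
    finally have "two_sided_cost (profile \<alpha> ?x - profile \<alpha> ?y) \<le> two_sided_cost ((fst v - fst w) - (snd v - snd w))"
      by (rule two_sided_cost_mono)
    also have "\<dots> \<le> smooth_abs (fst v - fst w) / 10 + smooth_abs (snd v - snd w) / 10"
      by (rule two_sided_cost_diff_le)
    finally show "two_sided_cost (profile \<alpha> ?x - profile \<alpha> ?y) \<le> smooth_abs (fst v - fst w) / 10 + smooth_abs (snd v - snd w) / 10" .
  qed measurable
qed

lemma measure_nu_outside_le: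
  assumes "0 \<le> M"
  shows "measure (nu \<alpha>) {x. M < \<bar>x\<bar>} \<le> exp (- profile \<alpha> M)"
proof -
  have "measure (nu \<alpha>) {x. M < \<bar>x\<bar>} \<le> measure (nu \<alpha>) ({..- M} \<union> {M..})"
    by (intro nu.finite_measure_mono) auto
  also have "\<dots> \<le> measure (nu \<alpha>) {..- M} + measure (nu \<alpha>) {M..}"
    by (intro measure_Un_le) auto
  also have "\<dots> = exp (- laplace_score \<alpha> M)"
    using assms by (simp add: measure_nu_reflect[OF \<alpha>] measure_nu_atLeast_score)
  also have "\<dots> \<le> exp (- profile \<alpha> M)"
    using profile_increment_le_score[of 0 M] assms profile_odd[OF \<alpha>, of 0] laplace_score_odd[of 0] by simp
  finally show ?thesis .
qed

end

section \<open>Displacements and the enlargement\<close>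

lemma smooth_abs_ge: "min (v\<^sup>2) \<bar>v\<bar> / 3 \<le> smooth_abs v"
proof -
  define s where "s = sqrt (1 + v\<^sup>2)"
  have s: "s\<^sup>2 = 1 + v\<^sup>2" "1 \<le> s" by (auto simp: s_def add_nonneg_nonneg)
  have sv: "s \<le> 1 + \<bar>v\<bar>"
    unfolding s_def by (rule real_le_lsqrt) (auto simp: power2_sum)
  have eq: "(s - 1) * (s + 1) = v\<^sup>2" using s(1) by (simp add: power2_eq_square algebra_simps)
  have "min (v\<^sup>2) \<bar>v\<bar> * (s + 1) \<le> 3 * v\<^sup>2"
  proof (cases "\<bar>v\<bar> \<le> 1")
    case True
    have "min (v\<^sup>2) \<bar>v\<bar> * (s + 1) \<le> v\<^sup>2 * 3"
      using True sv s(2) by (intro mult_mono) auto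
    then show ?thesis by simp
  next
    case False
    have "min (v\<^sup>2) \<bar>v\<bar> * (s + 1) \<le> \<bar>v\<bar> * (3 * \<bar>v\<bar>)"
      using False sv s(2) by (intro mult_mono) auto
    then show ?thesis by (simp add: power2_eq_square)
  qed
  also have "\<dots> = 3 * (s - 1) * (s + 1)" by (simp only: eq mult.assoc)
  finally have "min (v\<^sup>2) \<bar>v\<bar> \<le> 3 * (s - 1)" using s(2) by simp
  then show ?thesis by (simp add: smooth_abs_def s_def)
qed

lemma two_sided_cost_ge: "min (u\<^sup>2) \<bar>u\<bar> / 60 \<le> two_sided_cost u"
proof -
  have "min (u\<^sup>2) \<bar>u\<bar> / 4 \<le> min ((u / 2)\<^sup>2) \<bar>u / 2\<bar>" by (auto simp: min_def power_divide)
  then show ?thesis using smooth_abs_ge[of "u / 2"] unfolding two_sided_cost_def by linarith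
qed

lemma dilate_lp_ballI:
  assumes "0 < t" and z: "(\<Sum>i<n. \<bar>z i\<bar> powr p) \<le> t powr p"
  shows "restrict z {..<n} \<in> dilate n t (lp_ball n p)"
proof -
  define x where "x = restrict (\<lambda>i. z i / t) {..<n}"
  have "(\<Sum>i<n. \<bar>x i\<bar> powr p) = (\<Sum>i<n. \<bar>z i\<bar> powr p) / t powr p"
    using \<open>0 < t\<close> by (auto simp: x_def sum_divide_distrib powr_divide intro!: sum.cong)
  then have "x \<in> lp_ball n p" using z \<open>0 < t\<close> by (auto simp: lp_ball_def rspace_def x_def)
  moreover have "restrict z {..<n} = restrict (\<lambda>i. t * x i) {..<n}"
    using \<open>0 < t\<close> by (auto simp: x_def restrict_def)
  ultimately show ?thesis unfolding dilate_def by blast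
qed

lemma minkowski_sumI:
  assumes "restrict x {..<n} \<in> A" "restrict y {..<n} \<in> B"
  shows "restrict (\<lambda>i. x i + y i) {..<n} \<in> minkowski_sum n A B"
proof -
  have "restrict (\<lambda>i. x i + y i) {..<n} = restrict (\<lambda>i. restrict x {..<n} i + restrict y {..<n} i) {..<n}"
    by (auto simp: restrict_def)
  then show ?thesis unfolding minkowski_sum_def using assms by blast
qed

lemma dilateI: "restrict x {..<n} \<in> A \<Longrightarrow> restrict (\<lambda>i. t * x i) {..<n} \<in> dilate n t A"
proof -
  assume "restrict x {..<n} \<in> A"
  moreover have "restrict (\<lambda>i. t * x i) {..<n} = restrict (\<lambda>i. t * restrict x {..<n} i) {..<n}"
    by (auto simp: restrict_def)
  ultimately show ?thesis unfolding dilate_def by blast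
qed

lemma enlargementI:
  assumes x: "x \<in> A" "x \<in> rspace n" and y: "y \<in> rspace n" "\<And>i. i < n \<Longrightarrow> y i = x i + (p i + q i) + w i"
    and "0 < r" and l: "l = C * ln (real n) powr (1 / \<alpha> - 1)" "0 < l" and "0 < \<alpha>"
    and p: "(\<Sum>i<n. (p i)\<^sup>2) \<le> l\<^sup>2 * r" and q: "(\<Sum>i<n. \<bar>q i\<bar>) \<le> l * r" and w: "(\<Sum>i<n. \<bar>w i\<bar> powr \<alpha>) \<le> r"
  shows "y \<in> enlargement \<alpha> n C r A"
proof -
  have ext: "restrict z {..<n} = z" if "z \<in> rspace n" for z
    using that by (auto simp: rspace_def)
  have P: "restrict (\<lambda>i. p i / l) {..<n} \<in> dilate n (sqrt r) (lp_ball n 2)"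
  proof (rule dilate_lp_ballI)
    have "(\<Sum>i<n. \<bar>p i / l\<bar> powr 2) = (\<Sum>i<n. (p i)\<^sup>2) / l\<^sup>2"
      by (simp add: sum_divide_distrib power_divide)
    then show "(\<Sum>i<n. \<bar>p i / l\<bar> powr 2) \<le> sqrt r powr 2"
      using p \<open>0 < l\<close> \<open>0 < r\<close> by (simp add: divide_le_eq mult.commute)
  qed (use \<open>0 < r\<close> in auto)
  have Q: "restrict (\<lambda>i. q i / l) {..<n} \<in> dilate n r (lp_ball n 1)"
  proof (rule dilate_lp_ballI)
    have "(\<Sum>i<n. \<bar>q i / l\<bar> powr 1) = (\<Sum>i<n. \<bar>q i\<bar>) / l"
      using \<open>0 < l\<close> by (simp add: sum_divide_distrib abs_divide)
    then show "(\<Sum>i<n. \<bar>q i / l\<bar> powr 1) \<le> r powr 1"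
      using q \<open>0 < l\<close> \<open>0 < r\<close> by (simp add: divide_le_eq mult.commute)
  qed (use \<open>0 < r\<close> in auto)
  have W: "restrict w {..<n} \<in> dilate n (r powr (1 / \<alpha>)) (lp_ball n \<alpha>)"
    using w \<open>0 < r\<close> \<open>0 < \<alpha>\<close> by (intro dilate_lp_ballI) (auto simp: powr_powr)
  have "restrict (\<lambda>i. x i + l * (p i / l + q i / l) + w i) {..<n} \<in> enlargement \<alpha> n C r A"
    unfolding enlargement_def l(1)[symmetric] using x
    by (intro minkowski_sumI dilateI P Q W) (simp add: ext)
  also have "restrict (\<lambda>i. x i + l * (p i / l + q i / l) + w i) {..<n} = restrict y {..<n}"
    using y(2) \<open>0 < l\<close> by (auto simp: restrict_def field_simps)
  finally show ?thesis using ext[OF y(1)] by simp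
qed

lemma powr_increment_le:
  fixes p q a :: real
  assumes "0 < q" "q \<le> p" "1 \<le> a"
  shows "p powr a - q powr a \<le> a * p powr (a - 1) * (p - q)"
proof (cases "q < p")
  case True
  have "\<And>x. q \<le> x \<Longrightarrow> x \<le> p \<Longrightarrow> ((\<lambda>x. x powr a) has_real_derivative a * x powr (a - 1)) (at x)"
    using \<open>0 < q\<close> by (auto intro!: derivative_eq_intros)
  from MVT2[OF True this] obtain z where z: "q < z" "z < p" "p powr a - q powr a = (p - q) * (a * z powr (a - 1))"
    by blast
  have "(p - q) * (a * z powr (a - 1)) \<le> (p - q) * (a * p powr (a - 1))"
    using z assms by (intro mult_left_mono powr_mono2) auto
  then show ?thesis using z(3) by (simp add: mult_ac)
qed (use assms in simp)

definition log_factor :: "real \<Rightarrow> real" where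
  "log_factor \<alpha> = (2 + 4 * (1 / \<alpha> - 1) + 4 / \<alpha>) powr (1 / \<alpha> - 1)"

context
  fixes \<alpha> :: real
  assumes \<alpha>: "0 < \<alpha>" "\<alpha> < 1"
begin

text \<open>
  On the half-line \<open>y + offset\<close> is the power \<open>1/\<alpha>\<close> of an affine function of the profile, so a change of the
  profile by \<open>v/2\<close> moves a point by at most \<open>v\<close> times the largest derivative of that power on the
  range involved.  Points on opposite sides of the origin are both compared with the origin.
\<close>

lemma displacement_le_profile:
  fixes x y L :: real
  assumes "(offset \<alpha> + \<bar>x\<bar>) powr \<alpha> \<le> L"
  shows "\<bar>y - x\<bar> \<le> 1 / \<alpha> * (L + 2 * \<bar>profile \<alpha> y - profile \<alpha> x\<bar>) powr (1 / \<alpha> - 1)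
           * (2 * \<bar>profile \<alpha> y - profile \<alpha> x\<bar>)"
proof -
  let ?b = "offset \<alpha>"
  define s where "s r = (?b + r) powr \<alpha>" for r
  define v where "v = 2 * \<bar>profile \<alpha> y - profile \<alpha> x\<bar>"
  define D where "D = L + v"
  have b: "0 < ?b" by (rule offset_pos[OF \<alpha>])
  have s0: "s 0 = 2 / \<alpha>" by (simp add: s_def offset_powr[OF \<alpha>])
  have smono: "s r \<le> s r'" if "0 \<le> r" "r \<le> r'" for r r'
    using that b \<alpha> unfolding s_def by (intro powr_mono2) auto
  have P: "2 * profile \<alpha> r = s r - 2 / \<alpha>" if "0 \<le> r" for r
    using that by (simp add: profile_nonneg_eq[OF \<alpha>] s_def)
  have P': "2 * profile \<alpha> r = - (s (- r) - 2 / \<alpha>)" if "r \<le> 0" for r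
    using P[of "- r"] that by (simp add: profile_odd[OF \<alpha>])
  have inc: "r' - r \<le> 1 / \<alpha> * D powr (1 / \<alpha> - 1) * (s r' - s r)" if "0 \<le> r" "r \<le> r'" "s r' \<le> D" for r r'
  proof -
    have inv: "s r powr (1 / \<alpha>) = ?b + r" if "0 \<le> r" for r
      using that b \<alpha> by (simp add: s_def powr_powr)
    have "r' - r = s r' powr (1 / \<alpha>) - s r powr (1 / \<alpha>)" using that inv[of r] inv[of r'] by simp
    also have "\<dots> \<le> 1 / \<alpha> * s r' powr (1 / \<alpha> - 1) * (s r' - s r)"
      using that smono[of r r'] b \<alpha> by (intro powr_increment_le) (auto simp: s_def)
    also have "\<dots> \<le> 1 / \<alpha> * D powr (1 / \<alpha> - 1) * (s r' - s r)"
      using that smono[of r r'] \<alpha> by (intro mult_right_mono mult_left_mono powr_mono2) (auto simp: s_def)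
    finally show ?thesis .
  qed
  have sx: "s \<bar>x\<bar> \<le> L" using assms by (simp add: s_def)
  have same: "\<bar>r' - r\<bar> \<le> 1 / \<alpha> * D powr (1 / \<alpha> - 1) * v"
    if "0 \<le> r" "0 \<le> r'" "s r \<le> L" "\<bar>s r' - s r\<bar> = v" for r r'
  proof -
    have "s r \<le> D" "s r' \<le> D" using that by (auto simp: D_def)
    then show ?thesis
      using inc[of r r'] inc[of r' r] smono[of r r'] smono[of r' r] that by (cases "r \<le> r'") auto
  qed
  have opp: "r + r' \<le> 1 / \<alpha> * D powr (1 / \<alpha> - 1) * v"
    if "0 \<le> r" "0 \<le> r'" "s r \<le> L" "(s r - s 0) + (s r' - s 0) = v" for r r'
  proof -
    have "s r \<le> D" "s r' \<le> D" using that smono[of 0 r] smono[of 0 r'] by (auto simp: D_def)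
    then have "r - 0 \<le> 1 / \<alpha> * D powr (1 / \<alpha> - 1) * (s r - s 0)" "r' - 0 \<le> 1 / \<alpha> * D powr (1 / \<alpha> - 1) * (s r' - s 0)"
      using inc[of 0 r] inc[of 0 r'] that by auto
    then have "r + r' \<le> 1 / \<alpha> * D powr (1 / \<alpha> - 1) * ((s r - s 0) + (s r' - s 0))"
      unfolding distrib_left by linarith
    then show ?thesis by (simp only: that(4))
  qed
  have vabs: "v = \<bar>2 * profile \<alpha> y - 2 * profile \<alpha> x\<bar>"
    by (simp only: v_def right_diff_distrib[symmetric] abs_mult abs_numeral)
  have "\<bar>y - x\<bar> \<le> 1 / \<alpha> * D powr (1 / \<alpha> - 1) * v"
  proof -
    consider "0 \<le> x" "0 \<le> y" | "x \<le> 0" "y \<le> 0" | "0 \<le> x" "y \<le> 0" | "x \<le> 0" "0 \<le> y" by linarith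
    then show ?thesis
    proof cases
      case 1
      then have "\<bar>s \<bar>y\<bar> - s \<bar>x\<bar>\<bar> = v" by (simp add: vabs P)
      then show ?thesis using same[of "\<bar>x\<bar>" "\<bar>y\<bar>"] sx 1 by simp
    next
      case 2
      then have "\<bar>s \<bar>y\<bar> - s \<bar>x\<bar>\<bar> = v" by (simp add: vabs P' abs_minus_commute)
      then have "\<bar>\<bar>y\<bar> - \<bar>x\<bar>\<bar> \<le> 1 / \<alpha> * D powr (1 / \<alpha> - 1) * v"
        using same[of "\<bar>x\<bar>" "\<bar>y\<bar>"] sx by simp
      moreover have "\<bar>y - x\<bar> = \<bar>\<bar>y\<bar> - \<bar>x\<bar>\<bar>" using 2 by linarith
      ultimately show ?thesis by (simp only:)
    next
      case 3
      then have "(s \<bar>x\<bar> - s 0) + (s \<bar>y\<bar> - s 0) = v"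
        using smono[of 0 "\<bar>x\<bar>"] smono[of 0 "\<bar>y\<bar>"] by (simp add: vabs P P' s0)
      then have "\<bar>x\<bar> + \<bar>y\<bar> \<le> 1 / \<alpha> * D powr (1 / \<alpha> - 1) * v"
        using opp[of "\<bar>x\<bar>" "\<bar>y\<bar>"] sx by simp
      then show ?thesis by linarith
    next
      case 4
      then have "(s \<bar>x\<bar> - s 0) + (s \<bar>y\<bar> - s 0) = v"
        using smono[of 0 "\<bar>x\<bar>"] smono[of 0 "\<bar>y\<bar>"] by (simp add: vabs P P' s0)
      then have "\<bar>x\<bar> + \<bar>y\<bar> \<le> 1 / \<alpha> * D powr (1 / \<alpha> - 1) * v"
        using opp[of "\<bar>x\<bar>" "\<bar>y\<bar>"] sx by simp
      then show ?thesis by linarith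
    qed
  qed
  then show ?thesis by (simp add: D_def v_def)
qed

text \<open>
  The two terms have different origins: the first is the linear effect, whose factor is bounded on a
  cube, the second is the displacement of a point that travels far beyond the cube.
\<close>

lemma displacement_le:
  fixes x y L :: real
  assumes "(offset \<alpha> + \<bar>x\<bar>) powr \<alpha> \<le> L"
  defines "u \<equiv> \<bar>profile \<alpha> y - profile \<alpha> x\<bar>" and "k \<equiv> 1 / \<alpha> - 1"
  shows "\<bar>y - x\<bar> \<le> (2 * 4 powr k / \<alpha>) * (L powr k * u + u powr (1 / \<alpha>))"
proof -
  have k: "0 < k" using \<alpha> by (simp add: k_def)
  have u: "0 \<le> u" by (simp add: u_def)
  have L: "0 \<le> L" using order.trans[OF powr_ge_zero assms(1)] .
  have "(L + 2 * u) powr k \<le> (2 * max L (2 * u)) powr k"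
    using k L u by (intro powr_mono2) auto
  also have "\<dots> = 2 powr k * max L (2 * u) powr k" using L u by (simp add: powr_mult)
  also have "\<dots> \<le> 2 powr k * (L powr k + (2 * u) powr k)"
    by (intro mult_left_mono) (auto simp: max_def)
  also have "\<dots> \<le> 2 powr k * (2 powr k * L powr k + 2 powr k * u powr k)"
    using k u by (intro mult_left_mono add_mono) (auto simp: powr_mult ge_one_powr_ge_zero mult_le_cancel_right1)
  also have "\<dots> = 4 powr k * (L powr k + u powr k)"
    by (simp add: distrib_left mult.assoc[symmetric] powr_mult[symmetric])
  finally have "(L + 2 * u) powr k \<le> 4 powr k * (L powr k + u powr k)" .
  then have "1 / \<alpha> * (L + 2 * u) powr k * (2 * u) \<le> 1 / \<alpha> * (4 powr k * (L powr k + u powr k)) * (2 * u)"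
    using \<alpha> u by (intro mult_right_mono mult_left_mono) auto
  also have "\<dots> = (2 * 4 powr k / \<alpha>) * (L powr k * u + u powr k * u)"
    by (simp add: algebra_simps add_divide_distrib)
  also have "u powr k * u = u powr (1 / \<alpha>)"
    using u k by (cases "u = 0") (auto simp: powr_mult_base mult.commute k_def)
  finally show ?thesis
    using displacement_le_profile[OF assms(1), of y] unfolding u_def k_def by linarith
qed

lemma sets_nu_pow: "sets (nu_pow \<alpha> n) = sets (borel_pow n)"
  unfolding nu_pow_def borel_pow_def by (rule sets_PiM_cong) (auto simp: sets_nu[OF \<alpha>])

lemma space_nu_pow: "space (nu_pow \<alpha> n) = rspace n"
  unfolding nu_pow_def rspace_def by (simp add: space_PiM space_nu[OF \<alpha>])

lemma prob_space_nu: "prob_space (nu \<alpha>)"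
  using real_distribution_nu[OF \<alpha>] by (simp add: real_distribution_def)

lemma prob_space_nu_pow: "prob_space (nu_pow \<alpha> n)"
  unfolding nu_pow_def by (intro prob_space_PiM prob_space_nu)

lemma transport_property_nu_pow:
  "transport_property (nu_pow \<alpha> n) (\<lambda>x y. \<Sum>i<n. two_sided_cost (profile \<alpha> (x i) - profile \<alpha> (y i)))"
  unfolding nu_pow_def using prob_space_nu
  by (intro transport_property_PiM transport_property_nu[OF \<alpha>]) (auto intro: prob_space_imp_sigma_finite)

lemma measurable_coordinate: "i < n \<Longrightarrow> (\<lambda>x. x i) \<in> borel_measurable (nu_pow \<alpha> n)"
  unfolding nu_pow_def using measurable_component_singleton[of i "{..<n}" "\<lambda>_. nu \<alpha>"]
  by (simp add: measurable_cong_sets[OF refl sets_nu[OF \<alpha>]])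

lemma measure_nu_pow_outside_cube_le:
  assumes "0 \<le> M"
  shows "measure (nu_pow \<alpha> n) {x \<in> rspace n. \<exists>i<n. M < \<bar>x i\<bar>} \<le> n * exp (- profile \<alpha> M)"
proof -
  interpret N: prob_space "nu_pow \<alpha> n" by (rule prob_space_nu_pow)
  interpret product_prob_space "\<lambda>_::nat. nu \<alpha>" "{..<n}"
    by (rule product_prob_spaceI) (rule prob_space_nu)
  let ?S = "\<lambda>i. {x \<in> rspace n. M < \<bar>x i\<bar>}"
  have S: "?S i \<in> sets (nu_pow \<alpha> n)" if "i < n" for i
  proof -
    have [measurable]: "(\<lambda>x. x i) \<in> borel_measurable (nu_pow \<alpha> n)" by (rule measurable_coordinate[OF that])
    show ?thesis unfolding space_nu_pow[symmetric] by measurable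
  qed
  have m: "measure (nu_pow \<alpha> n) (?S i) \<le> exp (- profile \<alpha> M)" if "i < n" for i
  proof -
    have "measure (nu \<alpha>) {x. M < \<bar>x\<bar>} = measure (distr (nu_pow \<alpha> n) (nu \<alpha>) (\<lambda>x. x i)) {x. M < \<bar>x\<bar>}"
      using that by (simp add: nu_pow_def PiM_component)
    also have "\<dots> = measure (nu_pow \<alpha> n) (?S i)"
      using measurable_coordinate[OF that]
      by (subst measure_distr)
        (auto simp: measurable_cong_sets[OF refl sets_nu[OF \<alpha>]] sets_nu[OF \<alpha>] space_nu_pow intro!: arg_cong[where f = "measure _"])
    finally show ?thesis using measure_nu_outside_le[OF \<alpha> assms] by simp
  qed
  have "{x \<in> rspace n. \<exists>i<n. M < \<bar>x i\<bar>} = (\<Union>i\<in>{..<n}. ?S i)" by auto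
  then have "measure (nu_pow \<alpha> n) {x \<in> rspace n. \<exists>i<n. M < \<bar>x i\<bar>} \<le> (\<Sum>i<n. measure (nu_pow \<alpha> n) (?S i))"
    using S by (auto intro!: N.finite_measure_subadditive_finite)
  also have "\<dots> \<le> (\<Sum>i<n. exp (- profile \<alpha> M))" by (intro sum_mono m) auto
  finally show ?thesis by simp
qed

text \<open>
  The cube that carries all but \<open>1/C\<close> of the mass has size governed by \<open>ln (n * C)\<close>.  A power of
  \<open>ln C\<close> is at most a multiple of \<open>C\<close>; this is why the enlargement may carry a single linear factor
  \<open>C\<close>.
\<close>

lemma cube_radius_powr_le:
  assumes n: "2 \<le> n" and C: "1 \<le> C"
  shows "(2 * ln (real n * C) + 2 / \<alpha>) powr (1 / \<alpha> - 1) \<le> log_factor \<alpha> * (C * ln (real n) powr (1 / \<alpha> - 1))"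
proof -
  define k where "k = 1 / \<alpha> - 1"
  have k: "0 < k" using \<alpha> by (simp add: k_def)
  define c where "c = C powr (1 / k)"
  have c: "1 \<le> c" using C k by (simp add: c_def ge_one_powr_ge_zero)
  have "ln c = ln C / k" using C by (simp add: c_def ln_powr)
  then have "ln C = k * ln c" using k by simp
  also have "\<dots> \<le> k * c" using c k less_imp_le[OF ln_less_self, of c] by (intro mult_left_mono) linarith+
  finally have lnC: "ln C \<le> k * c" .
  have "1 / 2 \<le> ln (2::real)" using ln2_ge_two_thirds by simp
  also have "ln 2 \<le> ln (real n)" using n by simp
  finally have lnn: "1 / 2 \<le> ln (real n)" .
  then have half: "1 \<le> 2 * ln (real n)" by simp
  have t1: "2 * ln (real n) \<le> 2 * (ln (real n) * c)" using c lnn by simp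
  have t2: "2 * ln C \<le> 4 * k * (ln (real n) * c)"
  proof -
    have "2 * (k * c) * 1 \<le> 2 * (k * c) * (2 * ln (real n))"
      using half k c by (intro mult_left_mono) auto
    then show ?thesis using lnC by (simp add: algebra_simps)
  qed
  have t3: "2 / \<alpha> \<le> 4 / \<alpha> * (ln (real n) * c)"
  proof -
    have "1 * 1 \<le> (2 * ln (real n)) * c" using half c by (intro mult_mono) auto
    then have "2 / \<alpha> * 1 \<le> 2 / \<alpha> * ((2 * ln (real n)) * c)"
      using \<alpha> by (intro mult_left_mono) auto
    then show ?thesis by (simp add: algebra_simps)
  qed
  have "2 * ln (real n * C) + 2 / \<alpha> = 2 * ln (real n) + 2 * ln C + 2 / \<alpha>"
    using n C by (simp add: ln_mult)
  also have "\<dots> \<le> (2 + 4 * k + 4 / \<alpha>) * (ln (real n) * c)"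
    unfolding distrib_right using t1 t2 t3 by linarith
  finally have "(2 * ln (real n * C) + 2 / \<alpha>) powr k \<le> ((2 + 4 * k + 4 / \<alpha>) * (ln (real n) * c)) powr k"
    using k n C \<alpha> by (intro powr_mono2) (auto simp: ln_mult)
  also have "\<dots> = (2 + 4 * k + 4 / \<alpha>) powr k * (ln (real n) powr k * c powr k)"
    using k \<alpha> c lnn by (simp add: powr_mult)
  also have "c powr k = C" using k C by (simp add: c_def powr_powr)
  finally show ?thesis by (simp add: log_factor_def k_def mult_ac)
qed

text \<open>
  Split the displacement \<open>d = y - x\<close> by coordinates according to the profile change \<open>u\<close>.  Where \<open>u \<le> 1\<close> the
  cost is quadratic and \<open>d\<close> is bounded by a multiple of \<open>l * u\<close>: these coordinates form the Euclidean part
  \<open>p\<close>.  Where \<open>u > 1\<close> the cost is linear; there \<open>d\<close> is clipped at a multiple of \<open>l * u\<close>, which gives the part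
  \<open>q\<close> with small absolute sum, and the excess \<open>w\<close> is at most a multiple of \<open>u powr (1/\<alpha>)\<close>, so the sum of its \<open>\<alpha>\<close>-th
  powers is again bounded by the cost.  The constant \<open>c\<close> is small enough for all three budgets.
\<close>

lemma mem_enlargement_of_small_cost:
  fixes C r L :: real and n :: nat
  defines "K \<equiv> 2 * 4 powr (1 / \<alpha> - 1) / \<alpha>"
  defines "c \<equiv> 1 / (60 * (1 + (2 * K * log_factor \<alpha>)\<^sup>2 + 2 * K * log_factor \<alpha> + K powr \<alpha>))"
  assumes n: "2 \<le> n" and "0 < r" and C: "1 \<le> C" and x: "x \<in> A" "x \<in> rspace n" and y: "y \<in> rspace n"
    and L: "L = 2 * ln (real n * C) + 2 / \<alpha>" "\<And>i. i < n \<Longrightarrow> (offset \<alpha> + \<bar>x i\<bar>) powr \<alpha> \<le> L"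
    and cost: "(\<Sum>i<n. two_sided_cost (profile \<alpha> (x i) - profile \<alpha> (y i))) < c * r"
  shows "y \<in> enlargement \<alpha> n C r A"
proof -
  define k where "k = 1 / \<alpha> - 1"
  define l where "l = C * ln (real n) powr k"
  define u where "u i = \<bar>profile \<alpha> (y i) - profile \<alpha> (x i)\<bar>" for i
  define K1 where "K1 = 2 * K * log_factor \<alpha>"
  define d where "d i = y i - x i" for i
  define m where "m i = min ((u i)\<^sup>2) (u i)" for i
  have k: "0 < k" using \<alpha> by (simp add: k_def)
  have K: "0 < K" using \<alpha> by (simp add: K_def)
  have K1: "0 \<le> K1" using K by (simp add: K1_def log_factor_def)
  have l: "0 < l" using n C by (simp add: l_def)
  have u: "0 \<le> u i" for i by (simp add: u_def)
  have m: "0 \<le> m i" for i using u by (simp add: m_def)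
  have c: "c = 1 / (60 * (1 + K1\<^sup>2 + K1 + K powr \<alpha>))" by (simp add: c_def K1_def)
  have denom: "0 < 1 + K1\<^sup>2 + K1 + K powr \<alpha>" using K1 by (simp add: add_pos_nonneg)
  have cK: "q * (60 * (c * r)) \<le> r" if "q \<le> K1\<^sup>2 \<or> q \<le> K1 \<or> q \<le> K powr \<alpha>" for q
  proof -
    have "q \<le> 1 + K1\<^sup>2 + K1 + K powr \<alpha>" using that K1 by (smt (verit) powr_ge_zero zero_le_power2)
    then have "q * r \<le> (1 + K1\<^sup>2 + K1 + K powr \<alpha>) * r" using \<open>0 < r\<close> by (intro mult_right_mono) auto
    then show ?thesis using denom by (simp add: c field_simps)
  qed
  have summ: "(\<Sum>i<n. m i) \<le> 60 * (c * r)"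
  proof -
    have "m i / 60 \<le> two_sided_cost (profile \<alpha> (x i) - profile \<alpha> (y i))" for i
      using two_sided_cost_ge[of "profile \<alpha> (x i) - profile \<alpha> (y i)"]
      by (simp add: m_def u_def abs_minus_commute power2_commute)
    then have "(\<Sum>i<n. m i / 60) \<le> (\<Sum>i<n. two_sided_cost (profile \<alpha> (x i) - profile \<alpha> (y i)))"
      by (intro sum_mono)
    then show ?thesis using cost by (simp flip: sum_divide_distrib)
  qed
  have "1 \<le> 2 / \<alpha>" using \<alpha> by simp
  moreover have "0 \<le> ln (real n * C)" using n C by (simp add: ln_mult)
  ultimately have L1: "1 \<le> L" unfolding L(1) by linarith
  have "2 * K * L powr k \<le> 2 * K * (log_factor \<alpha> * l)"
    using cube_radius_powr_le[OF n C] K unfolding L(1) l_def k_def by (intro mult_left_mono) auto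
  then have KL: "2 * K * L powr k \<le> K1 * l" by (simp add: K1_def mult_ac)
  have dle: "\<bar>d i\<bar> \<le> K * (L powr k * u i) + K * u i powr (1 / \<alpha>)" if "i < n" for i
    using displacement_le[OF L(2)[OF that], of "y i"] by (simp add: d_def u_def K_def k_def distrib_left)
  have d1: "\<bar>d i\<bar> \<le> K1 * l * u i" if "i < n" "u i \<le> 1" for i
  proof -
    have "u i powr (1 / \<alpha>) \<le> u i powr 1"
      using that u[of i] \<alpha> by (intro powr_mono') auto
    also have "u i powr 1 \<le> L powr k * u i"
      using u[of i] L1 k by (simp add: mult_le_cancel_right1 ge_one_powr_ge_zero)
    finally have "K * u i powr (1 / \<alpha>) \<le> K * (L powr k * u i)" using K by simp
    then have "\<bar>d i\<bar> \<le> 2 * K * L powr k * u i" using dle[OF that(1)] by simp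
    also have "\<dots> \<le> K1 * l * u i" using KL u by (intro mult_right_mono) auto
    finally show ?thesis .
  qed
  define t where "t i = K1 * l * u i" for i
  have t: "0 \<le> t i" for i using K1 l u by (simp add: t_def)
  (* The clipped part q absorbs the linear effect; the excess w is nonzero only where the
     displacement exceeds t. *)
  define p where "p i = (if u i \<le> 1 then d i else 0)" for i
  define q where "q i = (if u i \<le> 1 then 0 else max (- t i) (min (t i) (d i)))" for i
  define w where "w i = d i - p i - q i" for i
  have w: "\<bar>w i\<bar> powr \<alpha> \<le> K powr \<alpha> * m i" if "i < n" for i
  proof (cases "u i \<le> 1")
    case True
    then show ?thesis using m[of i] by (simp add: w_def p_def q_def)
  next
    case False
    have "0 \<le> K * (L powr k * u i)" using K u[of i] by simp
    then have "K * (L powr k * u i) \<le> 2 * K * L powr k * u i" by (simp add: mult_ac)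
    also have "\<dots> \<le> t i" unfolding t_def using KL u by (intro mult_right_mono) auto
    finally have "\<bar>d i\<bar> \<le> t i + K * u i powr (1 / \<alpha>)" using dle[OF that] by simp
    moreover have "0 \<le> K * u i powr (1 / \<alpha>)" using K by simp
    ultimately have "\<bar>w i\<bar> \<le> K * u i powr (1 / \<alpha>)"
      using False t[of i] by (auto simp: w_def p_def q_def max_def min_def)
    then have "\<bar>w i\<bar> powr \<alpha> \<le> (K * u i powr (1 / \<alpha>)) powr \<alpha>" using \<alpha> by (intro powr_mono2) auto
    also have "\<dots> = K powr \<alpha> * u i" using K u[of i] \<alpha> by (simp add: powr_mult powr_powr)
    also have "m i = u i" using False by (simp add: m_def min_def power2_eq_square)
    then have "K powr \<alpha> * u i = K powr \<alpha> * m i" by simp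
    finally show ?thesis .
  qed
  have p2: "(p i)\<^sup>2 \<le> (K1\<^sup>2 * l\<^sup>2) * m i" if "i < n" for i
  proof (cases "u i \<le> 1")
    case True
    have "\<bar>d i\<bar>\<^sup>2 \<le> (K1 * l * u i)\<^sup>2" using d1[OF that True] by (intro power_mono) auto
    moreover have "m i = (u i)\<^sup>2" using True u[of i] by (simp add: m_def min_def power2_eq_square mult_left_le)
    ultimately show ?thesis using True by (simp add: p_def power_mult_distrib)
  qed (use m[of i] in \<open>simp add: p_def\<close>)
  have q1: "\<bar>q i\<bar> \<le> (K1 * l) * m i" for i
  proof (cases "u i \<le> 1")
    case False
    have "\<bar>q i\<bar> \<le> t i" using t[of i] False by (auto simp: q_def max_def min_def)
    moreover have "m i = u i" using False by (simp add: m_def min_def power2_eq_square)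
    ultimately show ?thesis by (simp add: t_def)
  qed (use m[of i] K1 l in \<open>simp add: q_def\<close>)
  show ?thesis
  proof (rule enlargementI[where p = p and q = q and w = w and l = l])
    show "x \<in> A" "x \<in> rspace n" "y \<in> rspace n" "0 < r" "0 < l" "0 < \<alpha>" by fact+
    show "y i = x i + (p i + q i) + w i" for i by (simp add: w_def d_def)
    show "l = C * ln (real n) powr (1 / \<alpha> - 1)" by (simp add: l_def k_def)
    have "(\<Sum>i<n. (p i)\<^sup>2) \<le> (\<Sum>i<n. (K1\<^sup>2 * l\<^sup>2) * m i)" by (intro sum_mono p2) auto
    also have "\<dots> \<le> (K1\<^sup>2 * l\<^sup>2) * (60 * (c * r))"
      unfolding sum_distrib_left[symmetric] by (intro mult_left_mono summ) auto
    also have "\<dots> = l\<^sup>2 * (K1\<^sup>2 * (60 * (c * r)))" by simp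
    also have "\<dots> \<le> l\<^sup>2 * r" by (intro mult_left_mono cK) auto
    finally show "(\<Sum>i<n. (p i)\<^sup>2) \<le> l\<^sup>2 * r" .
    have "(\<Sum>i<n. \<bar>q i\<bar>) \<le> (\<Sum>i<n. (K1 * l) * m i)" by (intro sum_mono q1)
    also have "\<dots> \<le> (K1 * l) * (60 * (c * r))"
      unfolding sum_distrib_left[symmetric] using K1 l by (intro mult_left_mono summ) auto
    also have "\<dots> = l * (K1 * (60 * (c * r)))" by simp
    also have "\<dots> \<le> l * r" using l by (intro mult_left_mono cK) auto
    finally show "(\<Sum>i<n. \<bar>q i\<bar>) \<le> l * r" .
    have "(\<Sum>i<n. \<bar>w i\<bar> powr \<alpha>) \<le> (\<Sum>i<n. K powr \<alpha> * m i)" by (intro sum_mono w) auto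
    also have "\<dots> \<le> K powr \<alpha> * (60 * (c * r))"
      unfolding sum_distrib_left[symmetric] by (intro mult_left_mono summ) auto
    also have "\<dots> \<le> r" by (intro cK) auto
    finally show "(\<Sum>i<n. \<bar>w i\<bar> powr \<alpha>) \<le> r" .
  qed
qed

end

section \<open>Concentration\<close>

text \<open>
  A set outside the completed \<open>\<sigma>\<close>-algebra has measure 0 by convention, and any other set differs by a
  null set from a measurable subset.  For the complement of the enlargement, which is
  coanalytic but in general not Borel, this leaves the Borel sets that avoid the enlargement.
\<close>

lemma measure_completion_le:
  assumes "0 \<le> b" and "\<And>B. B \<in> sets M \<Longrightarrow> B \<subseteq> S \<Longrightarrow> measure M B \<le> b"
  shows "measure (completion M) S \<le> b"
proof (cases "S \<in> sets (completion M)")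
  case True
  then have "measure (completion M) S = measure M (main_part M S)"
    by (simp add: measure_def)
  moreover have "main_part M S \<subseteq> S" using main_part_null_part_Un[OF True] by blast
  ultimately show ?thesis using assms(2)[of "main_part M S"] True by simp
next
  case False
  then show ?thesis using assms(1) by (simp add: measure_notin_sets)
qed

theorem proposition2p13:
  fixes \<alpha> :: real
  assumes "0 < \<alpha>" and "\<alpha> < 1"
  shows "\<exists>c::real. c > 0 \<and>
    (\<forall>n::nat. n \<ge> 2 \<longrightarrow>
      (\<forall>r::real. r > 0 \<longrightarrow>
        (\<forall>A \<in> sets (borel_pow n). \<forall>C::real. C > 0 \<longrightarrow>
          measure (nu_pow \<alpha> n) A > 1 / C \<longrightarrow>
          measure (nu_pow_complete \<alpha> n) {x \<in> rspace n. x \<notin> enlargement \<alpha> n C r A}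
            \<le> exp (- c * r) / (measure (nu_pow \<alpha> n) A - 1 / C))))"
proof -
  note \<alpha> = assms
  define K where "K = 2 * 4 powr (1 / \<alpha> - 1) / \<alpha>"
  define c where "c = 1 / (60 * (1 + (2 * K * log_factor \<alpha>)\<^sup>2 + 2 * K * log_factor \<alpha> + K powr \<alpha>))"
  have "0 \<le> 2 * K * log_factor \<alpha>" using \<alpha> by (simp add: K_def log_factor_def)
  then have "0 < 1 + (2 * K * log_factor \<alpha>)\<^sup>2 + 2 * K * log_factor \<alpha> + K powr \<alpha>"
    by (intro add_pos_nonneg) auto
  then have "0 < c" by (simp add: c_def)
  moreover have "measure (nu_pow_complete \<alpha> n) {x \<in> rspace n. x \<notin> enlargement \<alpha> n C r A}
            \<le> exp (- c * r) / (measure (nu_pow \<alpha> n) A - 1 / C)"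
    if n: "2 \<le> n" and "0 < r" and A: "A \<in> sets (borel_pow n)" and "0 < C" and big: "1 / C < measure (nu_pow \<alpha> n) A"
    for n r A C
  proof -
    interpret N: prob_space "nu_pow \<alpha> n" by (rule prob_space_nu_pow[OF \<alpha>])
    have [measurable]: "A \<in> sets (nu_pow \<alpha> n)" using A by (simp add: sets_nu_pow[OF \<alpha>])
    have "1 / C < 1" using big N.prob_le_1 order.strict_trans2 by blast
    then have C: "1 \<le> C" using \<open>0 < C\<close> by (simp add: divide_less_eq)
    (* M is the point at which the profile equals ln (n * C). *)
    define L where "L = 2 * ln (real n * C) + 2 / \<alpha>"
    define M where "M = L powr (1 / \<alpha>) - offset \<alpha>"
    have lnC: "0 \<le> ln (real n * C)" using n C by (simp add: ln_mult)
    then have Lge: "2 / \<alpha> \<le> L" "0 \<le> L" using \<alpha> by (auto simp: L_def)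
    have M0: "0 \<le> M"
      unfolding M_def offset_def using Lge \<alpha> by (auto intro!: powr_mono2)
    have radius_powr: "(offset \<alpha> + M) powr \<alpha> = L" using Lge \<alpha> by (simp add: M_def powr_powr)
    have "profile \<alpha> M = ln (real n * C)" using M0 by (simp add: profile_nonneg_eq[OF \<alpha>] radius_powr L_def)
    then have tail: "real n * exp (- profile \<alpha> M) = 1 / C" using n C by (simp add: exp_minus inverse_eq_divide)
    define T where "T = {x \<in> rspace n. \<exists>i<n. M < \<bar>x i\<bar>}"
    have "T = (\<Union>i\<in>{..<n}. {x \<in> space (nu_pow \<alpha> n). M < \<bar>x i\<bar>})" by (auto simp: T_def space_nu_pow[OF \<alpha>])
    moreover have "{x \<in> space (nu_pow \<alpha> n). M < \<bar>x i\<bar>} \<in> sets (nu_pow \<alpha> n)" if "i < n" for i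
    proof -
      have [measurable]: "(\<lambda>x. x i) \<in> borel_measurable (nu_pow \<alpha> n)" by (rule measurable_coordinate[OF \<alpha> that])
      show ?thesis by measurable
    qed
    ultimately have T[measurable]: "T \<in> sets (nu_pow \<alpha> n)" by auto
    have "measure (nu_pow \<alpha> n) T \<le> 1 / C"
      using measure_nu_pow_outside_cube_le[OF \<alpha> M0, of n] tail by (simp add: T_def)
    moreover have "measure (nu_pow \<alpha> n) A \<le> measure (nu_pow \<alpha> n) (A - T) + measure (nu_pow \<alpha> n) T"
      by (rule N.finite_measure_mono[THEN order.trans, OF _ _ measure_Un_le]) auto
    ultimately have AT: "measure (nu_pow \<alpha> n) A - 1 / C \<le> measure (nu_pow \<alpha> n) (A - T)" by linarith
    show ?thesis
      unfolding nu_pow_complete_def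
    proof (rule measure_completion_le)
      show "0 \<le> exp (- c * r) / (measure (nu_pow \<alpha> n) A - 1 / C)" using big by simp
      fix B assume B[measurable]: "B \<in> sets (nu_pow \<alpha> n)" and sub: "B \<subseteq> {x \<in> rspace n. x \<notin> enlargement \<alpha> n C r A}"
      have "measure (nu_pow \<alpha> n) (A - T) * measure (nu_pow \<alpha> n) B \<le> exp (- (c * r))"
      proof (rule transport_property_separated[OF N.finite_measure_axioms transport_property_nu_pow[OF \<alpha>]])
        fix x y assume x: "x \<in> A - T" and y: "y \<in> B"
        have xr: "x \<in> rspace n" using x sets.sets_into_space[OF \<open>A \<in> sets (nu_pow \<alpha> n)\<close>] by (auto simp: space_nu_pow[OF \<alpha>])
        show "c * r \<le> (\<Sum>i<n. two_sided_cost (profile \<alpha> (x i) - profile \<alpha> (y i)))"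
        proof (rule ccontr)
          assume "\<not> ?thesis"
          moreover have "(offset \<alpha> + \<bar>x i\<bar>) powr \<alpha> \<le> L" if "i < n" for i
          proof -
            have "\<bar>x i\<bar> \<le> M" using x xr that unfolding T_def by (metis (mono_tags, lifting) DiffD2 mem_Collect_eq not_less)
            then have "(offset \<alpha> + \<bar>x i\<bar>) powr \<alpha> \<le> (offset \<alpha> + M) powr \<alpha>"
              using \<alpha> offset_pos[OF \<alpha>] by (intro powr_mono2) auto
            then show ?thesis by (simp add: radius_powr)
          qed
          ultimately have "y \<in> enlargement \<alpha> n C r A"
            using x xr y sub n \<open>0 < r\<close> C unfolding c_def K_def
            by (intro mem_enlargement_of_small_cost[OF \<alpha>, where x = x and L = L]) (auto simp: L_def)
          then show False using y sub by auto
        qed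
      qed measurable
      moreover have "(measure (nu_pow \<alpha> n) A - 1 / C) * measure (nu_pow \<alpha> n) B \<le> measure (nu_pow \<alpha> n) (A - T) * measure (nu_pow \<alpha> n) B"
        using AT by (intro mult_right_mono) auto
      ultimately show "measure (nu_pow \<alpha> n) B \<le> exp (- c * r) / (measure (nu_pow \<alpha> n) A - 1 / C)"
        using big by (simp add: pos_le_divide_eq mult.commute)
    qed
  qed
  ultimately show ?thesis by blast
qed

end
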